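(* Let $\Xi$ be a standard manageable groupoid with unit space $X$, main orbit $X_0$, and $X_\infty:=X\setminus X_0$. Let $\mathbf T\subset\mathrm{Cl}(X)$ be closed in the Fell topology such that $X_\infty$ is an accumulation point of $\mathbf T$, and for every $M\in\mathbf T_0:=\mathbf T\setminus\{X_\infty\}$ one has $X_\infty\subset M$ and $X\setminus M$ is relatively compact in $X_0$. Let $h\in C_c(\Xi)$ be self-adjoint ($h(\xi^{-1})=\overline{h(\xi)}$). Define $\mathsf H\in\mathbb B[\ell^2(X_0)]$ by $(\mathsf Hu)(x)=\sum_{y\in X_0}h(\theta(x,y))u(y)$, and for $M\in\mathbf T_0$, with $M_0:=M\cap X_0$, define $\mathsf H_M\in\mathbb B[\ell^2(M_0)]$ by $(\mathsf H_Mv)(x)=\sum_{y\in M_0}h(\theta(x,y))v(y)$, $x\in M_0$. Then $$\inf\mathrm{sp}_{\rm ess}(\mathsf H)=\sup_{M\in\mathbf T_0}\big[\inf\mathrm{sp}(\mathsf H_M)\big],\qquad \sup\mathrm{sp}_{\rm ess}(\mathsf H)=\inf_{M\in\mathbf T_0}\big[\sup\mathrm{sp}(\mathsf H_M)\big].$$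
   Context: Manageable groupoid: Hausdorff locally compact $\sigma$-compact groupoid with compact unit space $X$, étale (range $\mathrm r$, domain $\mathrm d$ local homeomorphisms) and amenable. Standard: there is a closed invariant subset $X_\infty$ ($\mathrm d(\xi)\in X_\infty\Rightarrow \mathrm r(\xi)\in X_\infty$) such that $X_0=X\setminus X_\infty$ is a dense orbit whose isotropy groups $\Xi^z_z=\{\xi:\mathrm r(\xi)=z=\mathrm d(\xi)\}$ are trivial, and $\Xi(X_0)=\{\xi:\mathrm r(\xi),\mathrm d(\xi)\in X_0\}$ is second countable. $\theta:=(\mathrm r,\mathrm d)^{-1}:X_0\times X_0\to\Xi(X_0)$, i.e. $\theta(x,y)$ is the unique $\xi$ with $\mathrm r(\xi)=x$, $\mathrm d(\xi)=y$. $\mathrm{Cl}(X)$: closed subsets of $X$ with the Fell topology (basic open sets $\{A:A\cap K=\emptyset,\ A\cap\mathcal O\ne\emptyset\ \forall\mathcal O\in\mathfrak O\}$, $K$ compact, $\mathfrak O$ finite family of open sets). $\mathrm{sp}_{\rm ess}$ is the essential spectrum. *)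

theory Defs
  imports "HOL-Analysis.Analysis"
begin

text \<open>A groupoid is modelled on the whole type 'g: range map r, domain map d,
  partial multiplication mul (meaningful when d xi = r eta) and inversion iv.
  The unit space is X = range r.\<close>

definition unit_space :: "('g \<Rightarrow> 'g) \<Rightarrow> 'g set" where
  "unit_space r = range r"

definition groupoid ::
  "('g \<Rightarrow> 'g) \<Rightarrow> ('g \<Rightarrow> 'g) \<Rightarrow> ('g \<Rightarrow> 'g \<Rightarrow> 'g) \<Rightarrow> ('g \<Rightarrow> 'g) \<Rightarrow> bool" where
  "groupoid r d mul iv \<longleftrightarrow>
     (\<forall>x. r (r x) = r x \<and> d (r x) = r x \<and> r (d x) = d x \<and> d (d x) = d x) \<and>
     (\<forall>\<xi>. r (iv \<xi>) = d \<xi> \<and> d (iv \<xi>) = r \<xi> \<and> iv (iv \<xi>) = \<xi>) \<and>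
     (\<forall>\<xi> \<eta>. d \<xi> = r \<eta> \<longrightarrow> r (mul \<xi> \<eta>) = r \<xi> \<and> d (mul \<xi> \<eta>) = d \<eta>) \<and>
     (\<forall>\<xi> \<eta> \<zeta>. d \<xi> = r \<eta> \<and> d \<eta> = r \<zeta> \<longrightarrow>
        mul (mul \<xi> \<eta>) \<zeta> = mul \<xi> (mul \<eta> \<zeta>)) \<and>
     (\<forall>\<xi>. mul (r \<xi>) \<xi> = \<xi> \<and> mul \<xi> (d \<xi>) = \<xi>) \<and>
     (\<forall>\<xi>. mul \<xi> (iv \<xi>) = r \<xi> \<and> mul (iv \<xi>) \<xi> = d \<xi>)"

text \<open>Topological groupoid: multiplication continuous on composable pairs,
  inversion continuous (r, d continuous follows for etale below).\<close>
definition topological_groupoid ::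
  "('g::topological_space \<Rightarrow> 'g) \<Rightarrow> ('g \<Rightarrow> 'g) \<Rightarrow> ('g \<Rightarrow> 'g \<Rightarrow> 'g) \<Rightarrow> ('g \<Rightarrow> 'g) \<Rightarrow> bool" where
  "topological_groupoid r d mul iv \<longleftrightarrow>
     groupoid r d mul iv \<and>
     continuous_on {(\<xi>, \<eta>). d \<xi> = r \<eta>} (\<lambda>(\<xi>, \<eta>). mul \<xi> \<eta>) \<and>
     continuous_on UNIV iv"

definition local_homeo_onto :: "('g::topological_space \<Rightarrow> 'g) \<Rightarrow> 'g set \<Rightarrow> bool" where
  "local_homeo_onto f Y \<longleftrightarrow> f ` UNIV = Y \<and>
     (\<forall>\<xi>. \<exists>U. open U \<and> \<xi> \<in> U \<and> openin (top_of_set Y) (f ` U) \<and>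
            (\<exists>g. homeomorphism U (f ` U) f g))"

definition etale :: "('g::topological_space \<Rightarrow> 'g) \<Rightarrow> ('g \<Rightarrow> 'g) \<Rightarrow> bool" where
  "etale r d \<longleftrightarrow> local_homeo_onto r (unit_space r) \<and> local_homeo_onto d (unit_space r)"

definition Cc :: "('g::topological_space \<Rightarrow> 'a::real_normed_vector) \<Rightarrow> bool" where
  "Cc f \<longleftrightarrow> continuous_on UNIV f \<and> compact (closure {\<xi>. f \<xi> \<noteq> 0})"

text \<open>Topological amenability of an etale groupoid (Anantharaman-Delaroche--Renault):
  existence of a net (f_i) in C_c(Xi)^+ with sum over r-fibres tending to 1 uniformly
  on (the compact space) X and sum over r-fibres of |f_i(xi^-1 eta) - f_i(eta)| tending
  to 0 uniformly on compact subsets of Xi.  The existence of such a net is unfolded to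
  the equivalent (K, epsilon) form.\<close>
definition amenable ::
  "('g::topological_space \<Rightarrow> 'g) \<Rightarrow> ('g \<Rightarrow> 'g) \<Rightarrow> ('g \<Rightarrow> 'g \<Rightarrow> 'g) \<Rightarrow> ('g \<Rightarrow> 'g) \<Rightarrow> bool" where
  "amenable r d mul iv \<longleftrightarrow>
     (\<forall>K e. compact K \<and> e > 0 \<longrightarrow>
       (\<exists>f :: 'g \<Rightarrow> real. Cc f \<and> (\<forall>\<xi>. f \<xi> \<ge> 0) \<and>
          (\<forall>x \<in> unit_space r. \<bar>(\<Sum>\<^sub>\<infinity>\<eta> \<in> {\<eta>. r \<eta> = x}. f \<eta>) - 1\<bar> < e) \<and>
          (\<forall>\<xi> \<in> K. (\<Sum>\<^sub>\<infinity>\<eta> \<in> {\<eta>. r \<eta> = r \<xi>}. \<bar>f (mul (iv \<xi>) \<eta>) - f \<eta>\<bar>) < e)))"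

definition sigma_compact_space :: "'g::topological_space itself \<Rightarrow> bool" where
  "sigma_compact_space _ \<longleftrightarrow> (\<exists>K :: nat \<Rightarrow> 'g set. (\<forall>n. compact (K n)) \<and> (\<Union>n. K n) = UNIV)"

definition manageable ::
  "('g::t2_space \<Rightarrow> 'g) \<Rightarrow> ('g \<Rightarrow> 'g) \<Rightarrow> ('g \<Rightarrow> 'g \<Rightarrow> 'g) \<Rightarrow> ('g \<Rightarrow> 'g) \<Rightarrow> bool" where
  "manageable r d mul iv \<longleftrightarrow>
     topological_groupoid r d mul iv \<and>
     locally_compact_space (euclidean :: 'g topology) \<and>
     sigma_compact_space TYPE('g) \<and>
     compact (unit_space r) \<and>
     etale r d \<and>
     amenable r d mul iv"

definition standard_manageable ::
  "('g::t2_space \<Rightarrow> 'g) \<Rightarrow> ('g \<Rightarrow> 'g) \<Rightarrow> ('g \<Rightarrow> 'g \<Rightarrow> 'g) \<Rightarrow> ('g \<Rightarrow> 'g) \<Rightarrow> 'g set \<Rightarrow> bool" where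
  "standard_manageable r d mul iv Xinf \<longleftrightarrow>
     manageable r d mul iv \<and>
     Xinf \<subseteq> unit_space r \<and> closed Xinf \<and>
     (\<forall>\<xi>. d \<xi> \<in> Xinf \<longrightarrow> r \<xi> \<in> Xinf) \<and>
     (let X0 = unit_space r - Xinf in
        X0 \<noteq> {} \<and>
        (\<forall>x\<in>X0. \<forall>y\<in>X0. \<exists>\<xi>. r \<xi> = x \<and> d \<xi> = y) \<and>
        unit_space r \<subseteq> closure X0 \<and>
        (\<forall>\<xi>. r \<xi> \<in> X0 \<and> d \<xi> = r \<xi> \<longrightarrow> \<xi> = r \<xi>) \<and>
        second_countable (top_of_set {\<xi>. r \<xi> \<in> X0 \<and> d \<xi> \<in> X0}))"

definition theta :: "('g \<Rightarrow> 'g) \<Rightarrow> ('g \<Rightarrow> 'g) \<Rightarrow> 'g \<Rightarrow> 'g \<Rightarrow> 'g" where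
  "theta r d x y = (THE \<xi>. r \<xi> = x \<and> d \<xi> = y)"

definition fell_topology :: "'a::topological_space set \<Rightarrow> 'a set topology" where
  "fell_topology X = topology_generated_by
     {{A. closedin (top_of_set X) A \<and> A \<inter> K = {} \<and> (\<forall>V \<in> Os. A \<inter> V \<noteq> {})} | K Os.
        compact K \<and> K \<subseteq> X \<and> finite Os \<and> (\<forall>V \<in> Os. openin (top_of_set X) V)}"

definition l2 :: "'a set \<Rightarrow> ('a \<Rightarrow> complex) set" where
  "l2 S = {u. (\<forall>x. x \<notin> S \<longrightarrow> u x = 0) \<and> (\<lambda>x. (cmod (u x))\<^sup>2) summable_on S}"

definition l2norm :: "'a set \<Rightarrow> ('a \<Rightarrow> complex) \<Rightarrow> real" where
  "l2norm S u = sqrt (\<Sum>\<^sub>\<infinity>x\<in>S. (cmod (u x))\<^sup>2)"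

definition l2inner :: "'a set \<Rightarrow> ('a \<Rightarrow> complex) \<Rightarrow> ('a \<Rightarrow> complex) \<Rightarrow> complex" where
  "l2inner S u v = (\<Sum>\<^sub>\<infinity>x\<in>S. u x * cnj (v x))"

definition fin_dim :: "('a \<Rightarrow> complex) set \<Rightarrow> bool" where
  "fin_dim V \<longleftrightarrow> (\<exists>F. finite F \<and> (\<forall>v\<in>V. \<exists>c. v = (\<lambda>x. \<Sum>f\<in>F. c f * f x)))"

text \<open>Spectrum of a bounded operator T on l^2(S): lambda such that T - lambda is not
  a bijection of l^2(S) (bounded inverse is automatic by the inverse mapping theorem).\<close>
definition shift_op :: "(('a \<Rightarrow> complex) \<Rightarrow> ('a \<Rightarrow> complex)) \<Rightarrow> complex \<Rightarrow> ('a \<Rightarrow> complex) \<Rightarrow> ('a \<Rightarrow> complex)" where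
  "shift_op T c u = (\<lambda>x. T u x - c * u x)"

definition spectrum_l2 :: "'a set \<Rightarrow> (('a \<Rightarrow> complex) \<Rightarrow> ('a \<Rightarrow> complex)) \<Rightarrow> complex set" where
  "spectrum_l2 S T = {c. \<not> bij_betw (shift_op T c) (l2 S) (l2 S)}"

text \<open>Fredholm operators on l^2(S): finite-dimensional kernel, closed range,
  finite-dimensional orthogonal complement of the range (= finite codimension).\<close>
definition fredholm_l2 :: "'a set \<Rightarrow> (('a \<Rightarrow> complex) \<Rightarrow> ('a \<Rightarrow> complex)) \<Rightarrow> bool" where
  "fredholm_l2 S A \<longleftrightarrow>
     fin_dim {u \<in> l2 S. A u = (\<lambda>_. 0)} \<and>
     (\<forall>v w. (\<forall>n. v n \<in> A ` l2 S) \<and> w \<in> l2 S \<and>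
            (\<lambda>n. l2norm S (\<lambda>x. v n x - w x)) \<longlonglongrightarrow> 0 \<longrightarrow> w \<in> A ` l2 S) \<and>
     fin_dim {w \<in> l2 S. \<forall>v \<in> A ` l2 S. l2inner S v w = 0}"

definition ess_spectrum_l2 :: "'a set \<Rightarrow> (('a \<Rightarrow> complex) \<Rightarrow> ('a \<Rightarrow> complex)) \<Rightarrow> complex set" where
  "ess_spectrum_l2 S T = {c. \<not> fredholm_l2 S (shift_op T c)}"

definition kernel_op :: "('g \<Rightarrow> 'g) \<Rightarrow> ('g \<Rightarrow> 'g) \<Rightarrow> ('g \<Rightarrow> complex) \<Rightarrow> 'g set \<Rightarrow>
    ('g \<Rightarrow> complex) \<Rightarrow> ('g \<Rightarrow> complex)" where
  "kernel_op r d h S u = (\<lambda>x. if x \<in> S then (\<Sum>\<^sub>\<infinity>y\<in>S. h (theta r d x y) * u y) else 0)"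

definition real_part_set :: "complex set \<Rightarrow> real set" where
  "real_part_set A = {t. complex_of_real t \<in> A}"

end

theory Submission
  imports Defs
begin

text \<open>
  The main orbit \<open>X\<^sub>0\<close> is countable (it is the image of a discrete fibre of a second countable
  space) and locally compact, so by Baire it has an isolated point, and by transitivity all its
  points are isolated in the unit space. Hence every \<open>M \<inter> X\<^sub>0\<close> is cofinite in \<open>X\<^sub>0\<close>, while the
  accumulation hypothesis says that some \<open>M\<close> avoids any prescribed finite subset of \<open>X\<^sub>0\<close>. The
  operator has a bounded Hermitian kernel whose rows have uniformly bounded finite support.

  Let \<open>m(M)\<close> be the infimum of the numerical range on \<open>l\<^sup>2(M \<inter> X\<^sub>0)\<close>; it is the minimum of the
  spectrum of the compression to \<open>M\<close>. Put \<open>l = sup m(M)\<close>. For \<open>c < l\<close> the operator minus \<open>c\<close> is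
  coercive on a subspace of finite codimension, hence Fredholm. At \<open>l\<close> itself, almost minimising
  unit vectors supported far away form a singular Weyl sequence, so \<open>l\<close> is the minimum of the
  essential spectrum. The statement about suprema follows by replacing \<open>h\<close> with \<open>-h\<close>.
\<close>

section \<open>Symmetric operators on real Hilbert spaces\<close>

text \<open>Two steps need more than the variational picture. Spectrum and Fredholm property are
  phrased through bijectivity and closed ranges, so a contradiction has to extract a quantitative
  lower bound from bare surjectivity; for symmetric operators a gliding hump does this. And at l a
  small value of the quadratic form has to become a small norm of (H - l)u. The form of H - l need
  not be nonnegative on all of l2(X_0). One therefore fixes M1 with m(M1) > l - d, so that H_{M1} -
  (l - d) is nonnegative and the Cauchy-Schwarz inequality for semidefinite forms applies, and only
  then takes an almost minimising u on some M2 inside M1. Finite rows let M2 avoid every point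
  coupled to the complement of M1, so that H u and H_{M1} u coincide. All spaces l2(M) are closed
  subspaces of one real Hilbert space; complex scalars appear only where complex dimension
  counts.\<close>

lemma orthogonal_projection_exists:
  fixes R :: "'h::{real_inner,banach} set"
  assumes sub: "subspace R" and cl: "closed R"
  obtains p where "p \<in> R" "\<And>w. w \<in> R \<Longrightarrow> inner (x - p) w = 0"
proof -
  have R0: "R \<noteq> {}" using sub subspace_0 by blast
  define D where "D = Inf ((\<lambda>y. (norm (x - y))\<^sup>2) ` R)"
  have bdd: "bdd_below ((\<lambda>y. (norm (x - y))\<^sup>2) ` R)" by (rule bdd_belowI[of _ 0]) auto
  have Dle: "D \<le> (norm (x - y))\<^sup>2" if "y \<in> R" for y
    unfolding D_def by (rule cInf_lower) (use that bdd in auto)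
  have "\<exists>y\<in>R. (norm (x - y))\<^sup>2 < D + inverse (Suc n)" for n
  proof -
    have "D < D + inverse (Suc n)" by simp
    then show ?thesis unfolding D_def using cInf_lessD[of "(\<lambda>y. (norm (x - y))\<^sup>2) ` R"] R0 by blast
  qed
  then obtain y where yR: "\<And>n. y n \<in> R" and y: "\<And>n. (norm (x - y n))\<^sup>2 < D + inverse (Suc n)"
    by metis
  \<comment> \<open>Parallelogram law for \<open>x - y m\<close> and \<open>x - y n\<close>: the
    midpoint lies in R, so its squared distance to x is at least D, and the minimising sequence is
    Cauchy.\<close>
  have par: "(norm (y m - y n))\<^sup>2 \<le> 2 * inverse (Suc m) + 2 * inverse (Suc n)" for m n
  proof -
    have mid: "(1/2) *\<^sub>R (y m + y n) \<in> R"
      by (intro subspace_scale subspace_add sub yR)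
    have "(norm (y m - y n))\<^sup>2 = 2 * (norm (x - y m))\<^sup>2 + 2 * (norm (x - y n))\<^sup>2
        - 4 * (norm (x - (1/2) *\<^sub>R (y m + y n)))\<^sup>2"
      by (simp add: power2_norm_eq_inner inner_diff_left inner_diff_right inner_add_left
          inner_add_right inner_commute algebra_simps)
    with Dle[OF mid] y[of m] y[of n] show ?thesis by linarith
  qed
  have "Cauchy y"
  proof (rule metric_CauchyI)
    fix e :: real assume e: "0 < e"
    obtain N where N: "inverse (Suc N) < e\<^sup>2 / 4" using reals_Archimedean[of "e\<^sup>2/4"] e by auto
    have "dist (y m) (y n) < e" if "m \<ge> N" "n \<ge> N" for m n
    proof -
      have a: "inverse (real (Suc m)) \<le> inverse (Suc N)" "inverse (real (Suc n)) \<le> inverse (Suc N)"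
        using that by (auto intro!: le_imp_inverse_le)
      have "(norm (y m - y n))\<^sup>2 < e\<^sup>2" using par[of m n] a N by linarith
      then show ?thesis using e by (simp add: dist_norm power2_less_imp_less)
    qed
    then show "\<exists>M. \<forall>m\<ge>M. \<forall>n\<ge>M. dist (y m) (y n) < e" by blast
  qed
  then obtain p where p: "y \<longlonglongrightarrow> p" using Cauchy_convergent_iff convergent_def by blast
  have pR: "p \<in> R" using closed_sequentially[OF cl] yR p by blast
  have pD: "(norm (x - p))\<^sup>2 \<le> D"
  proof (rule LIMSEQ_le)
    show "(\<lambda>n. (norm (x - y n))\<^sup>2) \<longlonglongrightarrow> (norm (x - p))\<^sup>2" by (intro tendsto_intros p)
    show "(\<lambda>n. D + inverse (Suc n)) \<longlonglongrightarrow> D" using LIMSEQ_inverse_real_of_nat_add by simp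
  qed (use y less_imp_le in blast)
  have "inner (x - p) w = 0" if w: "w \<in> R" for w
  proof (cases "w = 0")
    case False
    \<comment> \<open>This t minimises the squared distance from x to the points
      \<open>p + t *\<^sub>R w\<close>, none of which can beat p.\<close>
    define t where "t = inner (x - p) w / inner w w"
    have "p + t *\<^sub>R w \<in> R" by (intro subspace_add subspace_scale sub pR w)
    from Dle[OF this] pD have "(norm (x - p))\<^sup>2 \<le> (norm (x - p - t *\<^sub>R w))\<^sup>2"
      by (metis diff_diff_eq order_trans)
    also have "\<dots> = (norm (x - p))\<^sup>2 - 2 * t * inner (x - p) w + t\<^sup>2 * inner w w"
      by (simp only: power2_norm_eq_inner) (simp add: inner_diff_left inner_diff_right 
          inner_commute algebra_simps power2_eq_square)
    also have "\<dots> = (norm (x - p))\<^sup>2 - (inner (x - p) w)\<^sup>2 / inner w w"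
      using False by (simp add: t_def power2_eq_square field_simps)
    finally have "(inner (x - p) w)\<^sup>2 / inner w w \<le> 0" by simp
    moreover have "inner w w > 0" using False by simp
    ultimately show ?thesis by (simp add: divide_le_0_iff)
  qed simp
  with pR that show ?thesis by blast
qed

text \<open>The vector is a sum of terms plus or minus \<open>(1/3)^n\<close> times
  \<open>x n\<close>. Each sign agrees with the partial sum so far, so the next partial sum has
  inner product of modulus at least \<open>(1/3)^n\<close> with \<open>x n\<close>. The ratio 1/3
  makes all later terms together at most half of that.\<close>

lemma gliding_hump:
  fixes R :: "'h::{real_inner,banach} set" and x :: "nat \<Rightarrow> 'h"
  assumes sub: "subspace R" and cl: "closed R"
    and xR: "\<And>n. x n \<in> R" and x1: "\<And>n. norm (x n) = 1"
  obtains w where "w \<in> R" "\<And>n. (1/3)^n / 2 \<le> \<bar>inner w (x n)\<bar>"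
proof -
  define sg where "sg v z = (if inner v z \<ge> 0 then 1 else (-1::real))" for v z :: 'h
  define s where "s = rec_nat 0 (\<lambda>n v. v + (sg v (x n) * (1/3)^n) *\<^sub>R x n)"
  have s0: "s 0 = 0" and sS: "s (Suc n) = s n + (sg (s n) (x n) * (1/3)^n) *\<^sub>R x n" for n
    by (simp_all add: s_def)
  define a where "a n = (sg (s n) (x n) * (1/3)^n) *\<^sub>R x n" for n
  have s_sum: "s n = (\<Sum>k<n. a k)" for n
    by (induction n) (simp_all add: s0 sS a_def)
  have na: "norm (a n) = (1/3)^n" for n by (simp add: a_def x1 sg_def)
  have sR: "s n \<in> R" for n
    by (induction n) (auto simp: s0 sS intro!: subspace_0 subspace_add subspace_scale sub xR)
  have summ_norm: "summable (\<lambda>n. norm (a n))" unfolding na by (rule summable_geometric) simp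
  then have summ: "summable a" by (rule summable_norm_cancel)
  define w where "w = suminf a"
  have lim: "s \<longlonglongrightarrow> w" unfolding w_def s_sum using summable_LIMSEQ[OF summ] .
  have wR: "w \<in> R" using closed_sequentially[OF cl] sR lim by blast
  have "(1/3)^n / 2 \<le> \<bar>inner w (x n)\<bar>" for n
  proof -
    have "w - s (Suc n) = (\<Sum>k. a (k + Suc n))"
      unfolding w_def s_sum using suminf_minus_initial_segment[OF summ, of "Suc n"] by simp
    also have "norm \<dots> \<le> (\<Sum>k. norm (a (k + Suc n)))"
      by (rule summable_norm) (use summ_norm summable_iff_shift[of "\<lambda>n. norm (a n)" "Suc n"] in simp)
    also have "\<dots> = (\<Sum>k. (1/3)^(Suc n) * (1/3)^k)"
      unfolding na by (simp add: power_add mult.commute)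
    also have "\<dots> = (1/3)^(Suc n) * (\<Sum>k. (1/3)^k)"
      by (rule suminf_mult) (simp add: summable_geometric)
    also have "\<dots> = (1/3)^n / 2" by (subst suminf_geometric) auto
    finally have tail: "norm (w - s (Suc n)) \<le> (1/3)^n / 2" .
    have "inner (s (Suc n)) (x n) = inner (s n) (x n) + sg (s n) (x n) * (1/3)^n"
      using x1[of n] by (simp add: sS inner_add_left norm_eq_sqrt_inner)
    then have big: "\<bar>inner (s (Suc n)) (x n)\<bar> \<ge> (1/3)^n"
      by (auto simp: sg_def abs_if)
    have "\<bar>inner (w - s (Suc n)) (x n)\<bar> \<le> (1/3)^n / 2"
      using Cauchy_Schwarz_ineq2[of "w - s (Suc n)" "x n"] tail x1[of n] by simp
    with big show ?thesis unfolding inner_diff_left by linarith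
  qed
  with wR that show ?thesis by blast
qed

text \<open>Without such a constant there are unit vectors \<open>x n\<close> in R with
  \<open>norm (A (x n)) < (1/4)^n\<close>. Their hump w is some \<open>A y\<close>, and symmetry
  gives \<open>(1/3)^n / 2 \<le> norm y * (1/4)^n\<close>, so \<open>(4/3)^n\<close> would stay
  bounded. This takes the role of the open mapping theorem.\<close>

lemma symmetric_bounded_below_on_closed_range:
  fixes R :: "'h::{real_inner,banach} set"
  assumes sub: "subspace R" and cl: "closed R" and lin: "linear A"
    and sym: "\<And>x y. inner (A x) y = inner x (A y)"
    and ran: "\<And>w. w \<in> R \<Longrightarrow> \<exists>y. w = A y"
  obtains c where "c > 0" "\<And>x. x \<in> R \<Longrightarrow> c * norm x \<le> norm (A x)"
proof (rule ccontr)
  assume "\<not> thesis"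
  with that have no: "\<exists>x\<in>R. norm (A x) < c * norm x" if "c > 0" for c
    using \<open>c > 0\<close> by (meson not_le)
  have "\<exists>x\<in>R. norm x = 1 \<and> norm (A x) < (1/4)^n" for n
  proof -
    obtain x where x: "x \<in> R" "norm (A x) < (1/4)^n * norm x" using no[of "(1/4)^n"] by auto
    then have nx: "norm x > 0" by (metis linear_0[OF lin] mult_zero_right norm_eq_zero less_irrefl zero_less_norm_iff)
    show ?thesis
    proof (intro bexI conjI)
      show "(1 / norm x) *\<^sub>R x \<in> R" by (intro subspace_scale sub x)
      show "norm ((1 / norm x) *\<^sub>R x) = 1" using nx by simp
      show "norm (A ((1 / norm x) *\<^sub>R x)) < (1/4)^n"
        using x nx by (simp add: linear_scale[OF lin] field_simps)
    qed
  qed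
  then obtain x where xR: "\<And>n. x n \<in> R" and x1: "\<And>n. norm (x n) = 1"
    and xA: "\<And>n. norm (A (x n)) < (1/4)^n" by metis
  obtain w where w: "w \<in> R" "\<And>n. (1/3)^n / 2 \<le> \<bar>inner w (x n)\<bar>"
    using gliding_hump[of R x] sub cl xR x1 by metis
  obtain y where y: "w = A y" using ran w by blast
  have "(4/3)^n \<le> 2 * norm y" for n
  proof -
    have "(1/3)^n / 2 \<le> \<bar>inner y (A (x n))\<bar>" using w(2)[of n] by (simp add: y sym)
    also have "\<dots> \<le> norm y * norm (A (x n))" by (rule Cauchy_Schwarz_ineq2)
    also have "\<dots> \<le> norm y * (1/4)^n" by (intro mult_left_mono) (use xA[of n] in auto)
    finally show ?thesis by (simp add: field_simps power_divide)
  qed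
  moreover have "\<exists>n. 2 * norm y < (4/3)^n" by (rule real_arch_pow) simp
  ultimately show False using not_le by blast
qed

text \<open>Lax-Milgram: solving \<open>A x = w\<close> is a fixed point problem for
  \<open>x - t *\<^sub>R (A x - w)\<close>, which coercivity makes a contraction of the complete set
  L.\<close>

lemma coercive_bij_betw:
  fixes L :: "'h::{real_inner,banach} set"
  assumes sub: "subspace L" and cl: "closed L" and A: "bounded_linear A"
    and AL: "A ` L \<subseteq> L" and e: "e > 0"
    and co: "\<And>x. x \<in> L \<Longrightarrow> e * (norm x)\<^sup>2 \<le> inner (A x) x"
  shows "bij_betw A L L"
proof -
  interpret A: bounded_linear A by fact
  obtain K where K: "K > 0" "\<And>x. norm (A x) \<le> norm x * K" using A.pos_bounded by blast
  have "inj_on A L"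
  proof (rule inj_onI)
    fix x y assume xy: "x \<in> L" "y \<in> L" "A x = A y"
    then have "e * (norm (x - y))\<^sup>2 \<le> 0"
      using co[of "x - y"] sub by (simp add: subspace_diff A.diff)
    then show "x = y" using e by (simp add: mult_le_0_iff)
  qed
  moreover have "w \<in> A ` L" if w: "w \<in> L" for w
  proof -
    \<comment> \<open>Minimises the bound \<open>1 - 2*t*e + t\<^sup>2*K\<^sup>2\<close> for the
      squared Lipschitz constant; the minimum is \<open>1 - e\<^sup>2 / K\<^sup>2\<close>.\<close>
    define t where "t = e / K\<^sup>2"
    define f where "f x = x - t *\<^sub>R (A x - w)" for x
    \<comment> \<open>On a nonzero L coercivity forces \<open>e \<le> K\<close>; the maximum with 0
      covers the zero subspace.\<close>
    define q where "q = max 0 (1 - e\<^sup>2 / K\<^sup>2)"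
    have t: "t > 0" using e K by (simp add: t_def)
    have q: "0 \<le> q" "q < 1" using e K by (auto simp: q_def)
    have "norm (f x - f y) \<le> sqrt q * norm (x - y)" if "x \<in> L" "y \<in> L" for x y
    proof -
      define z where "z = x - y"
      have z: "z \<in> L" using that sub by (simp add: z_def subspace_diff)
      have fz: "f x - f y = z - t *\<^sub>R A z" by (simp add: f_def z_def A.diff algebra_simps)
      have "(norm (z - t *\<^sub>R A z))\<^sup>2 = (norm z)\<^sup>2 - 2 * t * inner (A z) z + t\<^sup>2 * (norm (A z))\<^sup>2"
        by (simp only: power2_norm_eq_inner) (simp add: inner_diff_left inner_diff_right
          inner_commute algebra_simps power2_eq_square)
      also have "\<dots> \<le> (norm z)\<^sup>2 - 2 * t * (e * (norm z)\<^sup>2) + t\<^sup>2 * (norm z * K)\<^sup>2"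
        using co[OF z] t K(2)[of z] by (intro add_mono diff_mono mult_left_mono power_mono) auto
      also have "\<dots> = (1 - e\<^sup>2 / K\<^sup>2) * (norm z)\<^sup>2"
        using K by (simp add: t_def field_simps power2_eq_square)
      also have "\<dots> \<le> q * (norm z)\<^sup>2" by (intro mult_right_mono) (auto simp: q_def)
      finally show ?thesis
        unfolding fz by (metis z_def norm_ge_zero q(1) real_sqrt_le_mono real_sqrt_mult real_sqrt_unique)
    qed
    then have "\<exists>!x\<in>L. f x = x"
      using q w sub cl AL
      by (intro Banach_fix[of L "sqrt q"])
         (auto simp: dist_norm complete_eq_closed f_def intro!: subspace_diff subspace_scale dest: subspace_0)
    then obtain x where x: "x \<in> L" "f x = x" by blast
    then have "A x = w" using t by (simp add: f_def)
    with x show ?thesis by blast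
  qed
  ultimately show ?thesis using AL by (auto simp: bij_betw_def)
qed

text \<open>Cauchy-Schwarz for the semidefinite form of B, in the shape that turns a small form
  value into a small norm. It comes from positivity at \<open>u - (1/K) *\<^sub>R B u\<close>, which
  lies in L because u and \<open>B u\<close> do.\<close>

lemma nonneg_symmetric_norm_le:
  fixes L :: "'h::real_inner set"
  assumes sub: "subspace L" and lin: "linear B"
    and sym: "\<And>x y. inner (B x) y = inner x (B y)"
    and pos: "\<And>x. x \<in> L \<Longrightarrow> 0 \<le> inner (B x) x"
    and K: "K > 0" "\<And>x. norm (B x) \<le> K * norm x"
    and u: "u \<in> L" "B u \<in> L"
  shows "(norm (B u))\<^sup>2 \<le> K * inner (B u) u"
proof -
  define t where "t = 1 / K"
  have "u - t *\<^sub>R B u \<in> L" by (intro subspace_diff subspace_scale sub u)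
  from pos[OF this] have "0 \<le> inner (B u) u - 2 * t * (norm (B u))\<^sup>2 + t\<^sup>2 * inner (B (B u)) (B u)"
    by (simp add: linear_diff[OF lin] linear_scale[OF lin] inner_diff_left inner_diff_right 
        sym[of "B u" u] dot_square_norm power2_eq_square algebra_simps)
  also have "inner (B (B u)) (B u) \<le> K * (norm (B u))\<^sup>2"
    using norm_cauchy_schwarz[of "B (B u)" "B u"] K(2)[of "B u"] mult_right_mono[OF K(2)[of "B u"], of "norm (B u)"]
    by (simp add: power2_eq_square algebra_simps)
  finally have "0 \<le> inner (B u) u - 2 * t * (norm (B u))\<^sup>2 + t\<^sup>2 * (K * (norm (B u))\<^sup>2)"
    by (simp add: mult_left_mono)
  then show ?thesis using K(1) by (simp add: t_def field_simps power2_eq_square)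
qed

text \<open>Replacing f by its component g orthogonal to C exhibits the sum as the preimage of C
  under the continuous map that removes the g-component.\<close>

lemma closed_subspace_plus_line:
  fixes C :: "'h::{real_inner,banach} set"
  assumes sub: "subspace C" and cl: "closed C"
  shows "closed {c + t *\<^sub>R f | c t. c \<in> C}"
proof -
  obtain p where p: "p \<in> C" "\<And>w. w \<in> C \<Longrightarrow> inner (f - p) w = 0"
    using orthogonal_projection_exists[OF sub cl] by blast
  define g where "g = f - p"
  have "{c + t *\<^sub>R f | c t. c \<in> C} = (\<lambda>x. x - (inner g x / inner g g) *\<^sub>R g) -` C"
  proof (intro equalityI subsetI)
    fix x assume "x \<in> {c + t *\<^sub>R f | c t. c \<in> C}"
    then obtain c t where ct: "x = c + t *\<^sub>R f" "c \<in> C" by blast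
    have f: "f = g + p" by (simp add: g_def)
    have "inner g x = t * inner g g"
      using p ct by (simp add: f inner_add_right flip: g_def)
    \<comment> \<open>If f lies in C then g = 0 and both sides vanish.\<close>
    then have "(inner g x / inner g g) *\<^sub>R g = t *\<^sub>R g" by (cases "g = 0") auto
    then have "x - (inner g x / inner g g) *\<^sub>R g = x - t *\<^sub>R g" by (simp only:)
    also have "\<dots> = c + t *\<^sub>R p" by (simp add: ct f algebra_simps)
    finally have "x - (inner g x / inner g g) *\<^sub>R g = c + t *\<^sub>R p" .
    then show "x \<in> (\<lambda>x. x - (inner g x / inner g g) *\<^sub>R g) -` C"
      unfolding vimage_eq using sub ct(2) p(1) by (simp only: subspace_add subspace_scale)
  next
    fix x assume x: "x \<in> (\<lambda>x. x - (inner g x / inner g g) *\<^sub>R g) -` C"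
    define t where "t = inner g x / inner g g"
    have "x = (x - t *\<^sub>R g - t *\<^sub>R p) + t *\<^sub>R f" by (simp add: g_def algebra_simps)
    moreover have "x - t *\<^sub>R g - t *\<^sub>R p \<in> C"
      using x p sub by (auto simp: t_def intro: subspace_diff subspace_scale)
    ultimately show "x \<in> {c + t *\<^sub>R f | c t. c \<in> C}" by blast
  qed
  moreover have "closed \<dots>"
    by (intro continuous_closed_vimage cl) (auto intro!: continuous_intros simp: divide_inverse)
  ultimately show ?thesis by simp
qed

section \<open>The Hilbert space of square summable functions\<close>

text \<open>Functions live on the whole type rather than on a set: every \<open>l2 M\<close> becomes
  the closed subspace \<open>supported M\<close> of one Hilbert space, so operators for different M
  can be compared without changing the type.\<close>

typedef 'a ell2 = "{u :: 'a \<Rightarrow> complex. (\<lambda>i. (cmod (u i))\<^sup>2) summable_on UNIV}"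
  morphisms coord Ell2
  by (rule exI[of _ "\<lambda>_. 0"]) simp

setup_lifting type_definition_ell2

lemma summable_coord_sq: "(\<lambda>i. (cmod (coord x i))\<^sup>2) summable_on UNIV"
  using coord by auto

lemma norm_add_sq_le:
  fixes a b :: "'b::real_normed_vector"
  shows "(norm (a + b))\<^sup>2 \<le> 2 * (norm a)\<^sup>2 + 2 * (norm b)\<^sup>2"
proof -
  have "(norm (a + b))\<^sup>2 \<le> (norm a + norm b)\<^sup>2" by (intro power_mono norm_triangle_ineq) simp
  also have "\<dots> \<le> 2 * (norm a)\<^sup>2 + 2 * (norm b)\<^sup>2"
    using sum_squares_bound[of "norm a" "norm b"] by (simp add: power2_sum)
  finally show ?thesis .
qed

lemma square_summable_add:
  fixes u v :: "'a \<Rightarrow> complex"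
  assumes "(\<lambda>i. (cmod (u i))\<^sup>2) summable_on A" "(\<lambda>i. (cmod (v i))\<^sup>2) summable_on A"
  shows "(\<lambda>i. (cmod (u i + v i))\<^sup>2) summable_on A"
proof (rule summable_on_comparison_test)
  show "(\<lambda>i. 2 * (cmod (u i))\<^sup>2 + 2 * (cmod (v i))\<^sup>2) summable_on A"
    by (intro summable_on_add summable_on_cmult_right assms)
qed (use norm_add_sq_le in auto)

lemma square_summable_cmult:
  fixes u :: "'a \<Rightarrow> complex"
  assumes "(\<lambda>i. (cmod (u i))\<^sup>2) summable_on A"
  shows "(\<lambda>i. (cmod (c * u i))\<^sup>2) summable_on A"
  unfolding norm_mult power_mult_distrib by (intro summable_on_cmult_right assms)

instantiation ell2 :: (type) real_vector
begin
lift_definition zero_ell2 :: "'a ell2" is "\<lambda>_. 0" by simp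
lift_definition plus_ell2 :: "'a ell2 \<Rightarrow> 'a ell2 \<Rightarrow> 'a ell2" is "\<lambda>u v i. u i + v i"
  by (rule square_summable_add)
lift_definition uminus_ell2 :: "'a ell2 \<Rightarrow> 'a ell2" is "\<lambda>u i. - u i" by simp
lift_definition minus_ell2 :: "'a ell2 \<Rightarrow> 'a ell2 \<Rightarrow> 'a ell2" is "\<lambda>u v i. u i - v i"
proof -
  fix u v :: "'a \<Rightarrow> complex"
  assume u: "(\<lambda>i. (cmod (u i))\<^sup>2) summable_on UNIV" and v: "(\<lambda>i. (cmod (v i))\<^sup>2) summable_on UNIV"
  from v have "(\<lambda>i. (cmod (- v i))\<^sup>2) summable_on UNIV" by simp
  from square_summable_add[OF u this] show "(\<lambda>i. (cmod (u i - v i))\<^sup>2) summable_on UNIV" by simp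
qed
lift_definition scaleR_ell2 :: "real \<Rightarrow> 'a ell2 \<Rightarrow> 'a ell2" is "\<lambda>a u i. a *\<^sub>R u i"
  using square_summable_cmult by (simp add: scaleR_conv_of_real)
instance
  by standard (transfer; simp add: fun_eq_iff algebra_simps)+
end

text \<open>Complex scalars sit beside the real vector space structure; they are needed because
  \<open>fin_dim\<close> counts complex dimensions.\<close>

lift_definition cscale :: "complex \<Rightarrow> 'a ell2 \<Rightarrow> 'a ell2" is "\<lambda>c u i. c * u i"
  by (rule square_summable_cmult)

lemma coord_simps [simp]:
  "coord 0 i = 0" "coord (x + y) i = coord x i + coord y i" "coord (- x) i = - coord x i"
  "coord (x - y) i = coord x i - coord y i" "coord (a *\<^sub>R x) i = a *\<^sub>R coord x i"
  "coord (cscale c x) i = c * coord x i"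
  by (simp_all add: zero_ell2.rep_eq plus_ell2.rep_eq uminus_ell2.rep_eq minus_ell2.rep_eq
      scaleR_ell2.rep_eq cscale.rep_eq)

lemma ell2_eqI: "(\<And>i. coord x i = coord y i) \<Longrightarrow> x = y"
  by (rule coord_inject[THEN iffD1], rule ext)

lemma summable_coord_inner:
  "(\<lambda>i. inner (coord x i) (coord y i)) summable_on UNIV"
proof -
  have "(\<lambda>i. \<bar>inner (coord x i) (coord y i)\<bar>) summable_on UNIV"
  proof (rule summable_on_comparison_test)
    show "(\<lambda>i. (cmod (coord x i))\<^sup>2 + (cmod (coord y i))\<^sup>2) summable_on UNIV"
      by (intro summable_on_add summable_coord_sq)
    fix i
    show "\<bar>inner (coord x i) (coord y i)\<bar> \<le> (cmod (coord x i))\<^sup>2 + (cmod (coord y i))\<^sup>2"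
      using Cauchy_Schwarz_ineq2[of "coord x i" "coord y i"]
        sum_squares_bound[of "cmod (coord x i)" "cmod (coord y i)"]
        mult_nonneg_nonneg[of "cmod (coord x i)" "cmod (coord y i)"] by simp
  qed auto
  then show ?thesis using abs_summable_summable[of "\<lambda>i. inner (coord x i) (coord y i)" UNIV] by simp
qed

instantiation ell2 :: (type) real_inner
begin
text \<open>For complex numbers \<open>inner a b\<close> is the real part of
  \<open>a * cnj b\<close>, so this is the real part of the complex l2 product.\<close>

definition inner_ell2 :: "'a ell2 \<Rightarrow> 'a ell2 \<Rightarrow> real" where
  "inner_ell2 x y = (\<Sum>\<^sub>\<infinity>i. inner (coord x i) (coord y i))"
definition norm_ell2 :: "'a ell2 \<Rightarrow> real" where "norm_ell2 x = sqrt (inner x x)"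
definition dist_ell2 :: "'a ell2 \<Rightarrow> 'a ell2 \<Rightarrow> real" where "dist_ell2 x y = norm (x - y)"
definition sgn_ell2 :: "'a ell2 \<Rightarrow> 'a ell2" where "sgn_ell2 x = x /\<^sub>R norm x"
definition uniformity_ell2 :: "('a ell2 \<times> 'a ell2) filter" where
  "uniformity_ell2 = (INF e\<in>{0<..}. principal {(x, y). dist x y < e})"
definition open_ell2 :: "'a ell2 set \<Rightarrow> bool" where
  "open_ell2 U = (\<forall>x\<in>U. eventually (\<lambda>(x', y). x' = x \<longrightarrow> y \<in> U) uniformity)"
instance
proof
  fix x y z :: "'a ell2" and a :: real
  show "inner x y = inner y x" by (simp add: inner_ell2_def inner_commute)
  show "inner (x + y) z = inner x z + inner y z"
    unfolding inner_ell2_def coord_simps inner_add_left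
    by (intro infsum_add summable_coord_inner)
  show "inner (a *\<^sub>R x) y = a * inner x y"
    unfolding inner_ell2_def coord_simps inner_scaleR_left
    by (rule infsum_cmult_right) (rule summable_coord_inner)
  show "0 \<le> inner x x" unfolding inner_ell2_def by (intro infsum_nonneg) simp
  show "inner x x = 0 \<longleftrightarrow> x = 0"
  proof
    assume "inner x x = 0"
    then have "(\<Sum>\<^sub>\<infinity>i. inner (coord x i) (coord x i)) \<le> 0" by (simp only: inner_ell2_def)
    then have "inner (coord x i) (coord x i) = 0" for i
      by (rule nonneg_infsum_le_0D[OF _ summable_coord_inner]) auto
    then show "x = 0" by (intro ell2_eqI) simp
  qed (simp add: inner_ell2_def)
qed (rule norm_ell2_def dist_ell2_def sgn_ell2_def uniformity_ell2_def open_ell2_def)+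
end

lemma norm_ell2_sq: "(norm x)\<^sup>2 = (\<Sum>\<^sub>\<infinity>i. (cmod (coord x i))\<^sup>2)" for x :: "'a ell2"
  unfolding power2_norm_eq_inner inner_ell2_def ..

lemma sum_coord_le_norm_sq: "finite J \<Longrightarrow> (\<Sum>i\<in>J. (cmod (coord x i))\<^sup>2) \<le> (norm x)\<^sup>2"
  unfolding norm_ell2_sq by (rule finite_sum_le_infsum[OF summable_coord_sq]) auto

lemma cmod_coord_le_norm: "cmod (coord x i) \<le> norm x"
  using sum_coord_le_norm_sq[of "{i}" x] by simp

lemma norm_ell2_le:
  assumes "0 \<le> B" "\<And>J. finite J \<Longrightarrow> (\<Sum>i\<in>J. (cmod (coord x i))\<^sup>2) \<le> B\<^sup>2"
  shows "norm x \<le> B"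
proof -
  have "(norm x)\<^sup>2 \<le> B\<^sup>2"
    unfolding norm_ell2_sq by (rule infsum_le_finite_sums[OF summable_coord_sq]) (use assms in auto)
  then show ?thesis using assms(1) by (rule power2_le_imp_le)
qed

lemma norm_cscale: "norm (cscale c x) = cmod c * norm x"
proof -
  have "(norm (cscale c x))\<^sup>2 = (cmod c * norm x)\<^sup>2"
    unfolding norm_ell2_sq power_mult_distrib coord_simps norm_mult
    by (rule infsum_cmult_right) (rule summable_coord_sq)
  then show ?thesis by (simp add: power2_eq_iff_nonneg)
qed

lemma coord_Ell2:
  assumes "\<And>J. finite J \<Longrightarrow> (\<Sum>i\<in>J. (cmod (u i))\<^sup>2) \<le> B"
  shows "coord (Ell2 u) = u"
proof (rule Ell2_inverse)
  have "(\<lambda>i. (cmod (u i))\<^sup>2) summable_on UNIV"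
    by (rule nonneg_bdd_above_summable_on) (use assms in \<open>auto intro!: bdd_aboveI[of _ B]\<close>)
  then show "u \<in> {u. (\<lambda>i. (cmod (u i))\<^sup>2) summable_on UNIV}" by simp
qed

instance ell2 :: (type) banach
proof
  fix X :: "nat \<Rightarrow> 'a ell2" assume X: "Cauchy X"
  have "Cauchy (\<lambda>n. coord (X n) i)" for i
  proof (rule metric_CauchyI)
    fix e :: real assume "0 < e"
    then obtain M where "\<forall>m\<ge>M. \<forall>n\<ge>M. dist (X m) (X n) < e" using X metric_CauchyD by blast
    then have "dist (coord (X m) i) (coord (X n) i) < e" if "m \<ge> M" "n \<ge> M" for m n
      using cmod_coord_le_norm[of "X m - X n" i] that by (force simp: dist_norm)
    then show "\<exists>M. \<forall>m\<ge>M. \<forall>n\<ge>M. dist (coord (X m) i) (coord (X n) i) < e" by blast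
  qed
  then have "\<exists>l. (\<lambda>n. coord (X n) i) \<longlonglongrightarrow> l" for i
    using Cauchy_convergent_iff convergent_def by blast
  then obtain f where f: "\<And>i. (\<lambda>n. coord (X n) i) \<longlonglongrightarrow> f i" by metis
  \<comment> \<open>Bounds on finite sets of coordinates survive the limit in n; square summability
    of the limit and norm convergence both follow from them.\<close>
  have tail: "(\<Sum>i\<in>J. (cmod (coord (X m) i - f i))\<^sup>2) \<le> e\<^sup>2"
    if N: "\<And>m n. m \<ge> N \<Longrightarrow> n \<ge> N \<Longrightarrow> dist (X m) (X n) < e" and "m \<ge> N" "finite J" for N m e J
  proof (rule LIMSEQ_le_const2)
    show "(\<lambda>n. \<Sum>i\<in>J. (cmod (coord (X m) i - coord (X n) i))\<^sup>2) \<longlonglongrightarrow> (\<Sum>i\<in>J. (cmod (coord (X m) i - f i))\<^sup>2)"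
      by (intro tendsto_intros f)
    have "(\<Sum>i\<in>J. (cmod (coord (X m) i - coord (X n) i))\<^sup>2) \<le> e\<^sup>2" if "n \<ge> N" for n
    proof -
      have "(\<Sum>i\<in>J. (cmod (coord (X m) i - coord (X n) i))\<^sup>2) \<le> (norm (X m - X n))\<^sup>2"
        using sum_coord_le_norm_sq[OF \<open>finite J\<close>, of "X m - X n"] by (simp only: coord_simps)
      also have "\<dots> \<le> e\<^sup>2"
        using N[OF \<open>m \<ge> N\<close> that] by (intro power_mono) (auto simp: dist_norm)
      finally show ?thesis .
    qed
    then show "\<exists>N. \<forall>n\<ge>N. (\<Sum>i\<in>J. (cmod (coord (X m) i - coord (X n) i))\<^sup>2) \<le> e\<^sup>2" by blast
  qed
  obtain N1 where N1: "\<And>m n. m \<ge> N1 \<Longrightarrow> n \<ge> N1 \<Longrightarrow> dist (X m) (X n) < 1"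
    using metric_CauchyD[OF X, of 1] by auto
  \<comment> \<open>The pointwise limit f is not yet known to be square summable, but its difference
    to \<open>X N1\<close> is, by the tail estimate. The limit is then recovered as
    \<open>X N1 - g\<close>.\<close>
  define g where "g = Ell2 (\<lambda>i. coord (X N1) i - f i)"
  have g: "coord g i = coord (X N1) i - f i" for i
    unfolding g_def by (subst coord_Ell2[where B = "1\<^sup>2"]) (rule tail[OF N1 order_refl], assumption+, rule refl)
  define l where "l = X N1 - g"
  have l: "coord l i = f i" for i by (simp add: l_def g)
  have "X \<longlonglongrightarrow> l"
  proof (rule metric_LIMSEQ_I)
    fix e :: real assume e: "0 < e"
    then obtain N where N: "\<And>m n. m \<ge> N \<Longrightarrow> n \<ge> N \<Longrightarrow> dist (X m) (X n) < e/2"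
      using metric_CauchyD[OF X, of "e/2"] by auto
    have "dist (X n) l < e" if "n \<ge> N" for n
    proof -
      have "norm (X n - l) \<le> e/2"
      proof (rule norm_ell2_le)
        show "(\<Sum>i\<in>J. (cmod (coord (X n - l) i))\<^sup>2) \<le> (e/2)\<^sup>2" if "finite J" for J
          using tail[OF N \<open>n \<ge> N\<close> that] by (simp only: coord_simps l)
      qed (use e in simp)
      then show ?thesis using e by (simp add: dist_norm)
    qed
    then have "\<forall>n\<ge>N. dist (X n) l < e" by blast
    then show "\<exists>no. \<forall>n\<ge>no. dist (X n) l < e" ..
  qed
  then show "convergent X" by (auto simp: convergent_def)
qed

definition supported :: "'a set \<Rightarrow> 'a ell2 set" where
  "supported M = {x. \<forall>i. i \<notin> M \<longrightarrow> coord x i = 0}"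

lemma subspace_supported: "subspace (supported M)"
  by (auto simp: subspace_def supported_def)

lemma isCont_coord: "isCont (\<lambda>x. coord x i) a"
proof -
  have "bounded_linear (\<lambda>x. coord x i)"
    by (rule bounded_linear_intro[where K = 1]) (use cmod_coord_le_norm in auto)
  then show ?thesis by (rule linear_continuous_at)
qed

lemma closed_supported: "closed (supported M)"
proof -
  have "supported M = (\<Inter>i\<in>-M. (\<lambda>x. coord x i) -` {0})" by (auto simp: supported_def)
  then show ?thesis by (simp add: closed_INT continuous_closed_vimage isCont_coord)
qed

lemma supported_mono: "M \<subseteq> N \<Longrightarrow> supported M \<subseteq> supported N"
  by (auto simp: supported_def)

lemma l2_eq_coord_supported: "l2 M = coord ` supported M"
proof (intro equalityI subsetI)
  fix u assume u: "u \<in> l2 M"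
  then have "(\<lambda>i. (cmod (u i))\<^sup>2) summable_on UNIV"
    unfolding l2_def mem_Collect_eq
    by (subst summable_on_cong_neutral[where T = M and g = "\<lambda>i. (cmod (u i))\<^sup>2"]) auto
  then have "coord (Ell2 u) = u" by (simp add: Ell2_inverse)
  with u show "u \<in> coord ` supported M"
    by (intro image_eqI[of _ _ "Ell2 u"]) (auto simp: supported_def l2_def)
next
  fix u assume "u \<in> coord ` supported M"
  then show "u \<in> l2 M"
    unfolding l2_def supported_def using summable_on_subset_banach[OF summable_coord_sq] by auto
qed

lemma l2norm_coord:
  assumes "x \<in> supported M" shows "l2norm M (coord x) = norm x"
proof -
  have "(\<Sum>\<^sub>\<infinity>i\<in>M. (cmod (coord x i))\<^sup>2) = (norm x)\<^sup>2"
    unfolding norm_ell2_sq by (rule infsum_cong_neutral) (use assms in \<open>auto simp: supported_def\<close>)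
  then show ?thesis by (simp add: l2norm_def)
qed

text \<open>Complex orthogonality to a range is used later only through its real part, which is what
  the real inner product sees.\<close>

lemma Re_l2inner_coord:
  assumes "x \<in> supported M"
  shows "Re (l2inner M (coord x) (coord y)) = inner x y"
proof -
  have abs: "(\<lambda>i. cmod (coord x i * cnj (coord y i))) summable_on M"
  proof (rule summable_on_comparison_test)
    show "(\<lambda>i. (cmod (coord x i))\<^sup>2 + (cmod (coord y i))\<^sup>2) summable_on M"
      by (intro summable_on_add summable_on_subset_banach[OF summable_coord_sq]) auto
    fix i show "cmod (coord x i * cnj (coord y i)) \<le> (cmod (coord x i))\<^sup>2 + (cmod (coord y i))\<^sup>2"
      using sum_squares_bound[of "cmod (coord x i)" "cmod (coord y i)"]
        mult_nonneg_nonneg[of "cmod (coord x i)" "cmod (coord y i)", OF norm_ge_zero norm_ge_zero]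
      unfolding norm_mult complex_mod_cnj by linarith
  qed auto
  then have s: "(\<lambda>i. coord x i * cnj (coord y i)) summable_on M"
    by (rule abs_summable_summable)
  have "Re (l2inner M (coord x) (coord y)) = (\<Sum>\<^sub>\<infinity>i\<in>M. Re (coord x i * cnj (coord y i)))"
    unfolding l2inner_def by (rule infsum_Re[symmetric, OF s])
  also have "\<dots> = inner x y" unfolding inner_ell2_def
    by (rule infsum_cong_neutral) (use assms in \<open>auto simp: supported_def inner_complex_def\<close>)
  finally show ?thesis .
qed

section \<open>Finite-dimensional spaces of functions and Hermitian kernels\<close>

lemma fin_dim_mono: "V \<subseteq> W \<Longrightarrow> fin_dim W \<Longrightarrow> fin_dim V"
  unfolding fin_dim_def by (meson subsetD)

text \<open>Evaluation on G is injective on V. Inductively, the functions of V vanishing at a point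
  a form a subspace W, and a single v0 with \<open>v0 a \<noteq> 0\<close> spans V modulo W.\<close>

lemma fin_dim_if_determined_by_finite_set:
  assumes "finite G"
    and "\<And>v w c. v \<in> V \<Longrightarrow> w \<in> V \<Longrightarrow> (\<lambda>x. v x + c * w x) \<in> V"
    and "\<And>v. v \<in> V \<Longrightarrow> (\<And>x. x \<in> G \<Longrightarrow> v x = 0) \<Longrightarrow> v = (\<lambda>_. 0)"
  shows "fin_dim V"
  using assms
proof (induction G arbitrary: V rule: finite_induct)
  case empty
  then show ?case unfolding fin_dim_def by (intro exI[of _ "{}"]) auto
next
  case (insert a G)
  define W where "W = {v \<in> V. v a = 0}"
  have "fin_dim W"
  proof (rule insert.IH)
    show "(\<lambda>x. v x + c * w x) \<in> W" if "v \<in> W" "w \<in> W" for v w c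
      using that insert.prems(1) by (auto simp: W_def)
    show "v = (\<lambda>_. 0)" if "v \<in> W" "\<And>x. x \<in> G \<Longrightarrow> v x = 0" for v
      using insert.prems(2)[of v] that by (auto simp: W_def)
  qed
  then obtain F where F: "finite F" "\<And>v. v \<in> W \<Longrightarrow> \<exists>c. v = (\<lambda>x. \<Sum>f\<in>F. c f * f x)"
    unfolding fin_dim_def by blast
  show ?case
  proof (cases "V = W")
    case True then show ?thesis using \<open>fin_dim W\<close> by simp
  next
    case False
    then obtain v0 where v0: "v0 \<in> V" "v0 a \<noteq> 0" by (auto simp: W_def)
    have "\<exists>c. v = (\<lambda>x. \<Sum>f\<in>insert v0 F. c f * f x)" if v: "v \<in> V" for v
    proof -
      define b where "b = v a / v0 a"
      have "(\<lambda>x. v x + (- b) * v0 x) \<in> W"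
        using insert.prems(1)[OF v v0(1), of "- b"] v0 by (simp add: W_def b_def)
      then obtain c where c: "(\<lambda>x. v x + (- b) * v0 x) = (\<lambda>x. \<Sum>f\<in>F. c f * f x)" using F by blast
      have vx: "v x = b * v0 x + (\<Sum>f\<in>F. c f * f x)" for x
        using fun_cong[OF c, of x] by (simp add: algebra_simps)
      show ?thesis
      \<comment> \<open>The spanning set F is arbitrary and may already contain v0; then the two
        coefficients of v0 are merged.\<close>
      proof (cases "v0 \<in> F")
        case True
        have "v = (\<lambda>x. \<Sum>f\<in>F. (c f + (if f = v0 then b else 0)) * f x)"
          using True F(1) by (intro ext) (simp add: vx ring_distribs sum.distrib if_distribR
              if_distrib[of "\<lambda>z. z * _"] cong: if_cong)
        then show ?thesis using True by (auto simp: insert_absorb)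
      next
        case False
        have "v = (\<lambda>x. \<Sum>f\<in>insert v0 F. (c(v0 := b)) f * f x)"
          using False F(1) by (intro ext) (auto simp: vx intro!: sum.cong)
        then show ?thesis by blast
      qed
    qed
    then show ?thesis unfolding fin_dim_def using F(1) by (intro exI[of _ "insert v0 F"]) auto
  qed
qed

text \<open>Eliminating one spanning function per chosen point, as in Gaussian elimination.\<close>
lemma seminorm_le_sum_on_finite_set:
  fixes f :: "'i \<Rightarrow> 'a \<Rightarrow> complex" and p :: "('a \<Rightarrow> complex) \<Rightarrow> real"
  assumes "finite I"
    and "\<And>v w c. v \<in> V \<Longrightarrow> w \<in> V \<Longrightarrow> (\<lambda>x. v x + c * w x) \<in> V"
    and "\<And>v. v \<in> V \<Longrightarrow> \<exists>c. v = (\<lambda>x. \<Sum>i\<in>I. c i * f i x)"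
    and "\<And>v w c. v \<in> V \<Longrightarrow> w \<in> V \<Longrightarrow> p (\<lambda>x. v x + c * w x) \<le> p v + cmod c * p w"
    and "p (\<lambda>_. 0) = 0"
  shows "\<exists>G C. finite G \<and> C \<ge> 0 \<and> (\<forall>v\<in>V. p v \<le> C * (\<Sum>x\<in>G. cmod (v x)))"
  using assms
proof (induction "card I" arbitrary: I V f)
  case 0
  then have "v = (\<lambda>_. 0)" if "v \<in> V" for v using that by fastforce
  then show ?case using 0 by (intro exI[of _ "{}"] exI[of _ 0]) auto
next
  case (Suc n)
  show ?case
  proof (cases "\<forall>v\<in>V. v = (\<lambda>_. 0)")
    case True
    then show ?thesis using Suc by (intro exI[of _ "{}"] exI[of _ 0]) auto
  next
    case False
    then obtain v0 a where v0: "v0 \<in> V" "v0 a \<noteq> 0" by blast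
    obtain c0 where "v0 = (\<lambda>x. \<Sum>i\<in>I. c0 i * f i x)" using Suc.prems(3) v0 by blast
    with v0 have "(\<Sum>i\<in>I. c0 i * f i a) \<noteq> 0" by simp
    then have "\<exists>j\<in>I. c0 j * f j a \<noteq> 0" using sum.neutral[of I "\<lambda>i. c0 i * f i a"] by blast
    then obtain j where j: "j \<in> I" "f j a \<noteq> 0" by auto
    define W where "W = {v \<in> V. v a = 0}"
    \<comment> \<open>Subtracting multiples of the pivot \<open>f j\<close> makes every
      \<open>g i\<close> vanish at a and makes \<open>g j\<close> zero, so one index drops
      out.\<close>
    define g where "g i = (\<lambda>x. f i x - (f i a / f j a) * f j x)" for i
    have "\<exists>G C. finite G \<and> C \<ge> 0 \<and> (\<forall>v\<in>W. p v \<le> C * (\<Sum>x\<in>G. cmod (v x)))"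
    proof (rule Suc.hyps(1)[of "I - {j}" _ g])
      show "n = card (I - {j})" using Suc.hyps(2) j Suc.prems(1) by simp
      show "finite (I - {j})" using Suc.prems(1) by simp
      show "(\<lambda>x. v x + c * w x) \<in> W" if "v \<in> W" "w \<in> W" for v w c
        using that Suc.prems(2) by (auto simp: W_def)
      show "p (\<lambda>x. v x + c * w x) \<le> p v + cmod c * p w" if "v \<in> W" "w \<in> W" for v w c
        using that Suc.prems(4) by (auto simp: W_def)
      show "\<exists>c. v = (\<lambda>x. \<Sum>i\<in>I - {j}. c i * g i x)" if v: "v \<in> W" for v
      proof -
        obtain c where c: "v = (\<lambda>x. \<Sum>i\<in>I. c i * f i x)" using Suc.prems(3) v W_def by blast
        have 0: "(\<Sum>i\<in>I. c i * f i a) = 0" using v unfolding W_def c by simp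
        have "(\<Sum>i\<in>I - {j}. c i * g i x) = v x" for x
        proof -
          have "(\<Sum>i\<in>I - {j}. c i * g i x) = (\<Sum>i\<in>I. c i * g i x)"
            using j Suc.prems(1) by (intro sum.mono_neutral_left) (auto simp: g_def)
          also have "\<dots> = (\<Sum>i\<in>I. c i * f i x) - (\<Sum>i\<in>I. c i * f i a) * (f j x / f j a)"
            unfolding g_def sum_distrib_right sum_subtractf[symmetric]
            by (rule sum.cong) (simp_all add: algebra_simps)
          finally show ?thesis using 0 c by simp
        qed
        then show ?thesis by (intro exI[of _ c]) auto
      qed
    qed (rule Suc.prems(5))
    then obtain G C where GC: "finite G" "C \<ge> 0" "\<And>v. v \<in> W \<Longrightarrow> p v \<le> C * (\<Sum>x\<in>G. cmod (v x))"
      by blast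
    \<comment> \<open>Comes from v = w + b v0 with w in W and b = v a / v0 a: the first C accounts
      for v in the bound on p w, the fraction for the multiple of v0 both in that bound and in p v
      itself.\<close>
    define D where "D = C + (C * (\<Sum>x\<in>G. cmod (v0 x)) + \<bar>p v0\<bar>) / cmod (v0 a)"
    have "p v \<le> D * (\<Sum>x\<in>insert a G. cmod (v x))" if v: "v \<in> V" for v
    proof -
      define b where "b = v a / v0 a"
      define w where "w = (\<lambda>x. v x + (- b) * v0 x)"
      have w: "w \<in> W" unfolding W_def w_def using Suc.prems(2)[OF v v0(1), of "- b"] v0 by (simp add: b_def)
      define s where "s = (\<Sum>x\<in>insert a G. cmod (v x))"
      have sG: "(\<Sum>x\<in>G. cmod (v x)) \<le> s" unfolding s_def by (rule sum_mono2) (use GC in auto)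
      have sa: "cmod (v a) \<le> s" unfolding s_def by (rule member_le_sum) (use GC in auto)
      have "(\<Sum>x\<in>G. cmod (w x)) \<le> (\<Sum>x\<in>G. cmod (v x) + cmod b * cmod (v0 x))"
        unfolding w_def by (intro sum_mono order_trans[OF norm_triangle_ineq]) (simp add: norm_mult)
      also have "\<dots> = (\<Sum>x\<in>G. cmod (v x)) + cmod b * (\<Sum>x\<in>G. cmod (v0 x))"
        by (simp add: sum.distrib sum_distrib_left)
      finally have wG: "(\<Sum>x\<in>G. cmod (w x)) \<le> s + cmod b * (\<Sum>x\<in>G. cmod (v0 x))" using sG by simp
      have b: "cmod b \<le> s / cmod (v0 a)" using sa by (simp add: b_def norm_divide divide_right_mono)
      have "v = (\<lambda>x. w x + b * v0 x)" by (simp add: w_def)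
      then have "p v \<le> p w + cmod b * p v0"
        using Suc.prems(4)[of w v0 b] w v0 W_def by auto
      also have "\<dots> \<le> C * (s + cmod b * (\<Sum>x\<in>G. cmod (v0 x))) + cmod b * \<bar>p v0\<bar>"
        using GC(3)[OF w] mult_left_mono[OF wG GC(2)] by (intro add_mono mult_left_mono) auto
      also have "\<dots> = C * s + cmod b * (C * (\<Sum>x\<in>G. cmod (v0 x)) + \<bar>p v0\<bar>)" by (simp add: algebra_simps)
      also have "\<dots> \<le> C * s + s / cmod (v0 a) * (C * (\<Sum>x\<in>G. cmod (v0 x)) + \<bar>p v0\<bar>)"
        using b GC(2) by (intro add_left_mono mult_right_mono) (auto intro!: add_nonneg_nonneg mult_nonneg_nonneg sum_nonneg)
      also have "\<dots> = D * s" by (simp add: D_def algebra_simps add_divide_distrib)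
      finally show ?thesis unfolding s_def .
    qed
    moreover have "D \<ge> 0" unfolding D_def using GC(2)
      by (intro add_nonneg_nonneg divide_nonneg_nonneg mult_nonneg_nonneg sum_nonneg) auto
    ultimately show ?thesis using GC(1) by (intro exI[of _ "insert a G"] exI[of _ D]) auto
  qed
qed

text \<open>Equivalence of norms in finite dimension, with finitely many coordinates controlling the
  full norm. The spanning functions in \<open>fin_dim\<close> need not be square summable, so the
  seminorm is estimated only on members of V.\<close>

lemma fin_dim_norm_le_sum_on_finite_set:
  fixes V :: "'a ell2 set"
  assumes "fin_dim (coord ` V)" and sub: "\<And>v w c. v \<in> V \<Longrightarrow> w \<in> V \<Longrightarrow> v + cscale c w \<in> V"
  obtains G C where "finite G" "C \<ge> 0" "\<And>v. v \<in> V \<Longrightarrow> norm v \<le> C * (\<Sum>x\<in>G. cmod (coord v x))"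
proof -
  obtain F where F: "finite F" "\<And>v. v \<in> coord ` V \<Longrightarrow> \<exists>c. v = (\<lambda>x. \<Sum>f\<in>F. c f * f x)"
    using assms(1) unfolding fin_dim_def by blast
  have comb: "(\<lambda>x. coord v x + c * coord w x) = coord (v + cscale c w)" for v w c by auto
  have "\<exists>G C. finite G \<and> C \<ge> 0 \<and> (\<forall>u\<in>coord ` V. norm (Ell2 u) \<le> C * (\<Sum>x\<in>G. cmod (u x)))"
  proof (rule seminorm_le_sum_on_finite_set[where I = F and f = "\<lambda>f. f"])
    show "(\<lambda>x. v x + c * w x) \<in> coord ` V" if "v \<in> coord ` V" "w \<in> coord ` V" for v w c
      using that sub by (auto simp only: comb)
    show "norm (Ell2 (\<lambda>x. v x + c * w x)) \<le> norm (Ell2 v) + cmod c * norm (Ell2 w)"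
      if "v \<in> coord ` V" "w \<in> coord ` V" for v w c
    proof -
      from that obtain v' w' where "v = coord v'" "w = coord w'" by blast
      then show ?thesis
        using norm_triangle_ineq[of v' "cscale c w'"] by (simp add: comb coord_inverse norm_cscale)
    qed
    show "norm (Ell2 (\<lambda>_. 0)) = 0" by (simp flip: zero_ell2_def)
  qed (use F in auto)
  then obtain G C where "finite G" "C \<ge> 0" "\<And>u. u \<in> coord ` V \<Longrightarrow> norm (Ell2 u) \<le> C * (\<Sum>x\<in>G. cmod (u x))"
    by blast
  then show ?thesis using that[of G C] by (force simp: coord_inverse)
qed

section \<open>Operators given by bounded Hermitian kernels with uniformly finite rows\<close>

definition kop :: "('a \<Rightarrow> 'a \<Rightarrow> complex) \<Rightarrow> 'a set \<Rightarrow> ('a \<Rightarrow> complex) \<Rightarrow> 'a \<Rightarrow> complex" where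
  "kop k M u = (\<lambda>x. if x \<in> M then (\<Sum>\<^sub>\<infinity>y\<in>M. k x y * u y) else 0)"

text \<open>The kernel of interest is \<open>h (theta r d x y)\<close>: C will bound h, and N the
  number of points of an r-fibre where h is nonzero. Hermitian symmetry turns the row bounds into
  column bounds.\<close>

locale hermitian_kernel =
  fixes S :: "'a set" and k :: "'a \<Rightarrow> 'a \<Rightarrow> complex" and N :: nat and C :: real
  assumes herm: "x \<in> S \<Longrightarrow> y \<in> S \<Longrightarrow> k y x = cnj (k x y)"
    and bound: "x \<in> S \<Longrightarrow> y \<in> S \<Longrightarrow> cmod (k x y) \<le> C"
    and fin_row: "x \<in> S \<Longrightarrow> finite {y \<in> S. k x y \<noteq> 0}"
    and card_row: "x \<in> S \<Longrightarrow> card {y \<in> S. k x y \<noteq> 0} \<le> N"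
    and C_nonneg: "0 \<le> C"
begin

lemma card_row_le:
  assumes "x \<in> S" "Y \<subseteq> S" shows "card {y \<in> Y. k x y \<noteq> 0} \<le> N"
proof -
  have "card {y \<in> Y. k x y \<noteq> 0} \<le> card {y \<in> S. k x y \<noteq> 0}"
    by (rule card_mono) (use assms fin_row in auto)
  then show ?thesis using card_row assms by force
qed

lemma double_sum_le:
  fixes g :: "'a \<Rightarrow> real"
  assumes "finite J" "finite Y" "J \<subseteq> S" "Y \<subseteq> S" "\<And>x. g x \<ge> 0"
  shows "(\<Sum>x\<in>J. \<Sum>y\<in>{y \<in> Y. k x y \<noteq> 0}. g x) \<le> N * sum g J"
    and "(\<Sum>x\<in>J. \<Sum>y\<in>{y \<in> Y. k x y \<noteq> 0}. g y) \<le> N * sum g Y"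
proof -
  have 1: "(\<Sum>x\<in>J. \<Sum>y\<in>{y \<in> Y. k x y \<noteq> 0}. g x) \<le> N * sum g J" if "finite J" "J \<subseteq> S" "Y \<subseteq> S" for J Y
    unfolding sum_distrib_left sum_constant using that card_row_le assms(5)
    by (intro sum_mono mult_right_mono) (auto simp: subset_iff)
  from 1 show "(\<Sum>x\<in>J. \<Sum>y\<in>{y \<in> Y. k x y \<noteq> 0}. g x) \<le> N * sum g J" using assms by blast
  \<comment> \<open>Summation by columns; the zero pattern is symmetric, so columns are counted as
    rows.\<close>
  have "(\<Sum>x\<in>J. \<Sum>y\<in>{y \<in> Y. k x y \<noteq> 0}. g y) = (\<Sum>y\<in>Y. \<Sum>x\<in>{x \<in> J. k x y \<noteq> 0}. g y)"
    by (rule sum.swap_restrict) (use assms in auto)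
  also have "\<dots> = (\<Sum>y\<in>Y. \<Sum>x\<in>{x \<in> J. k y x \<noteq> 0}. g y)"
  proof (rule sum.cong[OF refl])
    fix y assume "y \<in> Y"
    then have "k y x = cnj (k x y)" if "x \<in> J" for x using herm that assms(3,4) by blast
    then have "{x \<in> J. k x y \<noteq> 0} = {x \<in> J. k y x \<noteq> 0}" by auto
    then show "(\<Sum>x\<in>{x \<in> J. k x y \<noteq> 0}. g y) = (\<Sum>x\<in>{x \<in> J. k y x \<noteq> 0}. g y)" by simp
  qed
  also have "\<dots> \<le> N * sum g Y" by (rule 1) (use assms in auto)
  finally show "(\<Sum>x\<in>J. \<Sum>y\<in>{y \<in> Y. k x y \<noteq> 0}. g y) \<le> N * sum g Y" .
qed

lemma kop_eq_sum:
  assumes "M \<subseteq> S" "x \<in> M" "finite Y" "{y \<in> M. k x y \<noteq> 0} \<subseteq> Y" "Y \<subseteq> M"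
  shows "kop k M u x = (\<Sum>y\<in>{y \<in> Y. k x y \<noteq> 0}. k x y * u y)"
proof -
  have "(\<Sum>\<^sub>\<infinity>y\<in>M. k x y * u y) = (\<Sum>\<^sub>\<infinity>y\<in>{y \<in> Y. k x y \<noteq> 0}. k x y * u y)"
    by (rule infsum_cong_neutral) (use assms in auto)
  then show ?thesis using assms by (simp add: kop_def)
qed

lemma kop_finite_row:
  assumes "M \<subseteq> S" "x \<in> M"
  shows "finite {y \<in> M. k x y \<noteq> 0}"
  by (rule finite_subset[OF _ fin_row[of x]]) (use assms in auto)

text \<open>Schur test by counting: Cauchy-Schwarz over a row of at most N entries gives
  \<open>N * C\<^sup>2\<close>, and each coordinate of u is met by at most N rows, which gives the
  second factor N.\<close>

lemma kop_bound:
  assumes M: "M \<subseteq> S" and J: "finite J"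
  shows "(\<Sum>x\<in>J. (cmod (kop k M (coord u) x))\<^sup>2) \<le> (N * C * norm u)\<^sup>2"
proof -
  define J' where "J' = J \<inter> M"
  define Y where "Y = (\<Union>x\<in>J'. {y \<in> M. k x y \<noteq> 0})"
  have Y: "finite Y" "Y \<subseteq> M" unfolding Y_def J'_def using J kop_finite_row[OF M] by auto
  have J': "finite J'" "J' \<subseteq> M" using J by (auto simp: J'_def)
  have row: "(cmod (kop k M (coord u) x))\<^sup>2 \<le> N * C\<^sup>2 * (\<Sum>y\<in>{y \<in> Y. k x y \<noteq> 0}. (cmod (coord u y))\<^sup>2)"
    if x: "x \<in> J'" for x
  proof -
    let ?I = "{y \<in> Y. k x y \<noteq> 0}"
    have "kop k M (coord u) x = (\<Sum>y\<in>?I. k x y * coord u y)"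
      by (rule kop_eq_sum) (use x M Y J' Y_def in auto)
    also have "cmod \<dots> \<le> (\<Sum>y\<in>?I. C * cmod (coord u y))"
      using x M Y J' bound
      by (intro order_trans[OF norm_sum] sum_mono) (auto simp: norm_mult subset_iff intro!: mult_right_mono)
    finally have "(cmod (kop k M (coord u) x))\<^sup>2 \<le> (\<Sum>y\<in>?I. C * cmod (coord u y))\<^sup>2"
      by (rule power_mono) simp
    also have "\<dots> \<le> (\<Sum>y\<in>?I. (C * cmod (coord u y))\<^sup>2) * card ?I"
      by (rule sum_squared_le_sum_of_squares)
    also have "\<dots> \<le> (\<Sum>y\<in>?I. (C * cmod (coord u y))\<^sup>2) * N"
      using card_row_le[of x Y] x J' Y M by (intro mult_left_mono sum_nonneg) auto
    also have "\<dots> = N * C\<^sup>2 * (\<Sum>y\<in>?I. (cmod (coord u y))\<^sup>2)"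
      by (simp add: power_mult_distrib sum_distrib_left mult_ac)
    finally show ?thesis .
  qed
  have "(\<Sum>x\<in>J. (cmod (kop k M (coord u) x))\<^sup>2) = (\<Sum>x\<in>J'. (cmod (kop k M (coord u) x))\<^sup>2)"
    by (rule sum.mono_neutral_right) (use J in \<open>auto simp: J'_def kop_def\<close>)
  also have "\<dots> \<le> (\<Sum>x\<in>J'. N * C\<^sup>2 * (\<Sum>y\<in>{y \<in> Y. k x y \<noteq> 0}. (cmod (coord u y))\<^sup>2))"
    by (intro sum_mono row)
  also have "\<dots> = N * C\<^sup>2 * (\<Sum>x\<in>J'. \<Sum>y\<in>{y \<in> Y. k x y \<noteq> 0}. (cmod (coord u y))\<^sup>2)"
    by (simp add: sum_distrib_left)
  also have "\<dots> \<le> N * C\<^sup>2 * (N * (\<Sum>y\<in>Y. (cmod (coord u y))\<^sup>2))"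
    by (intro mult_left_mono double_sum_le(2)) (use J' Y M in auto)
  also have "\<dots> \<le> N * C\<^sup>2 * (N * (norm u)\<^sup>2)"
    by (intro mult_left_mono sum_coord_le_norm_sq) (use Y in auto)
  finally show ?thesis by (simp add: power_mult_distrib power2_eq_square mult_ac)
qed

definition H :: "'a set \<Rightarrow> 'a ell2 \<Rightarrow> 'a ell2" where
  "H M u = Ell2 (kop k M (coord u))"

lemma coord_H: "M \<subseteq> S \<Longrightarrow> coord (H M u) = kop k M (coord u)"
  unfolding H_def using kop_bound by (rule coord_Ell2)

lemma H_supported: "M \<subseteq> S \<Longrightarrow> H M u \<in> supported M"
  by (simp add: supported_def coord_H kop_def)

lemma norm_H_le: "M \<subseteq> S \<Longrightarrow> norm (H M u) \<le> N * C * norm u"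
  using C_nonneg by (intro norm_ell2_le) (auto simp: coord_H kop_bound)

lemma coord_H_sum:
  "M \<subseteq> S \<Longrightarrow> x \<in> M \<Longrightarrow> coord (H M u) x = (\<Sum>y\<in>{y \<in> M. k x y \<noteq> 0}. k x y * coord u y)"
  using kop_eq_sum[of M x "{y \<in> M. k x y \<noteq> 0}"] kop_finite_row by (simp add: coord_H)

lemma coord_H_outside: "M \<subseteq> S \<Longrightarrow> x \<notin> M \<Longrightarrow> coord (H M u) x = 0"
  by (simp add: coord_H kop_def)

lemma H_add_cscale: "M \<subseteq> S \<Longrightarrow> H M (u + cscale c v) = H M u + cscale c (H M v)"
proof (rule ell2_eqI)
  fix x assume M: "M \<subseteq> S"
  show "coord (H M (u + cscale c v)) x = coord (H M u + cscale c (H M v)) x"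
    by (cases "x \<in> M") (use M in \<open>simp_all add: coord_H_outside coord_H_sum sum.distrib sum_distrib_left algebra_simps\<close>)
qed

lemma bounded_linear_H:
  assumes M: "M \<subseteq> S" shows "bounded_linear (H M)"
proof (rule bounded_linear_intro[where K = "N * C"])
  have sc: "a *\<^sub>R u = cscale (of_real a) u" for a and u :: "'a ell2"
    by (rule ell2_eqI) (simp add: scaleR_conv_of_real)
  have sc1: "cscale 1 u = u" for u :: "'a ell2" by (rule ell2_eqI) simp
  show add: "H M (u + v) = H M u + H M v" for u v
    using H_add_cscale[OF M, of u 1 v] by (simp add: sc1)
  have "H M 0 = 0" using add[of 0 0] by simp
  then show "H M (a *\<^sub>R u) = a *\<^sub>R H M u" for a u
    using H_add_cscale[OF M, of 0 "of_real a" u] by (simp add: sc)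
  show "norm (H M u) \<le> norm u * (N * C)" for u using norm_H_le[OF M, of u] by (simp add: mult_ac)
qed

text \<open>Fubini for the double series over pairs in M. It is absolutely summable because nonzero
  terms are at most C times a sum of two squared coordinates, and each coordinate occurs in at most
  N nonzero entries of its row or column.\<close>

lemma H_symmetric:
  assumes M: "M \<subseteq> S"
  shows "inner (H M u) v = inner u (H M v)"
proof -
  define f where "f x y = inner (k x y * coord u y) (coord v x)" for x y
  have f0: "f x y = 0" if "k x y = 0" for x y using that by (simp add: f_def)
  have fle: "\<bar>f x y\<bar> \<le> C * ((cmod (coord u y))\<^sup>2 + (cmod (coord v x))\<^sup>2)" if "x \<in> M" "y \<in> M" for x y
  proof -
    have "\<bar>f x y\<bar> \<le> cmod (k x y) * cmod (coord u y) * cmod (coord v x)"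
      unfolding f_def using Cauchy_Schwarz_ineq2[of "k x y * coord u y" "coord v x"] by (simp add: norm_mult)
    also have "\<dots> \<le> C * (cmod (coord u y) * cmod (coord v x))"
      using bound[of x y] that M by (simp add: mult.assoc mult_right_mono subset_iff)
    also have "\<dots> \<le> C * ((cmod (coord u y))\<^sup>2 + (cmod (coord v x))\<^sup>2)"
      using sum_squares_bound[of "cmod (coord u y)" "cmod (coord v x)"]
        mult_nonneg_nonneg[of "cmod (coord u y)" "cmod (coord v x)", OF norm_ge_zero norm_ge_zero]
      by (intro mult_left_mono C_nonneg) linarith
    finally show ?thesis .
  qed
  have "(\<lambda>(x, y). \<bar>f x y\<bar>) summable_on M \<times> M"
  proof (rule nonneg_bdd_above_summable_on)
    show "bdd_above (sum (\<lambda>(x, y). \<bar>f x y\<bar>) ` {F. F \<subseteq> M \<times> M \<and> finite F})"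
    proof (rule bdd_aboveI2)
      fix F assume "F \<in> {F. F \<subseteq> M \<times> M \<and> finite F}"
      then have F: "F \<subseteq> M \<times> M" "finite F" by auto
      define J Y where "J = fst ` F" and "Y = snd ` F"
      have J: "finite J" "J \<subseteq> M" and Y: "finite Y" "Y \<subseteq> M" using F by (auto simp: J_def Y_def)
      have "(\<Sum>(x, y)\<in>F. \<bar>f x y\<bar>) \<le> (\<Sum>(x, y)\<in>J \<times> Y. \<bar>f x y\<bar>)"
        using J Y by (intro sum_mono2) (auto simp: J_def Y_def image_iff split: prod.splits, force+)
      also have "\<dots> = (\<Sum>x\<in>J. \<Sum>y\<in>Y. \<bar>f x y\<bar>)" by (rule sum.cartesian_product[symmetric])
      also have "\<dots> = (\<Sum>x\<in>J. \<Sum>y\<in>{y \<in> Y. k x y \<noteq> 0}. \<bar>f x y\<bar>)"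
        using Y by (intro sum.cong[OF refl] sum.mono_neutral_right) (auto simp: f0)
      also have "\<dots> \<le> (\<Sum>x\<in>J. \<Sum>y\<in>{y \<in> Y. k x y \<noteq> 0}. C * ((cmod (coord u y))\<^sup>2 + (cmod (coord v x))\<^sup>2))"
        using J Y by (intro sum_mono fle) auto
      also have "\<dots> = C * ((\<Sum>x\<in>J. \<Sum>y\<in>{y \<in> Y. k x y \<noteq> 0}. (cmod (coord u y))\<^sup>2)
          + (\<Sum>x\<in>J. \<Sum>y\<in>{y \<in> Y. k x y \<noteq> 0}. (cmod (coord v x))\<^sup>2))"
        by (simp add: sum_distrib_left sum.distrib distrib_left mult_ac)
      also have "\<dots> \<le> C * (N * (\<Sum>y\<in>Y. (cmod (coord u y))\<^sup>2) + N * (\<Sum>x\<in>J. (cmod (coord v x))\<^sup>2))"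
        by (intro mult_left_mono add_mono double_sum_le C_nonneg) (use J Y M in auto)
      also have "\<dots> \<le> C * (N * (norm u)\<^sup>2 + N * (norm v)\<^sup>2)"
        by (intro mult_left_mono add_mono sum_coord_le_norm_sq C_nonneg J Y) auto
      finally show "(\<Sum>(x, y)\<in>F. \<bar>f x y\<bar>) \<le> C * (N * (norm u)\<^sup>2 + N * (norm v)\<^sup>2)" .
    qed
  qed auto
  then have summ: "(\<lambda>(x, y). f x y) summable_on M \<times> M"
    using abs_summable_summable[of "\<lambda>(x, y). f x y" "M \<times> M"] by (simp add: case_prod_unfold)
  have row: "(\<Sum>\<^sub>\<infinity>y\<in>M. f x y) = inner (coord (H M u) x) (coord v x)" if "x \<in> M" for x
  proof -
    have "(\<Sum>\<^sub>\<infinity>y\<in>M. f x y) = (\<Sum>\<^sub>\<infinity>y\<in>{y \<in> M. k x y \<noteq> 0}. f x y)"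
      by (rule infsum_cong_neutral) (auto simp: f0)
    also have "\<dots> = inner (coord (H M u) x) (coord v x)"
      using kop_finite_row[OF M that] by (simp add: coord_H_sum[OF M that] f_def inner_sum_left)
    finally show ?thesis .
  qed
  have col: "(\<Sum>\<^sub>\<infinity>x\<in>M. f x y) = inner (coord u y) (coord (H M v) y)" if y: "y \<in> M" for y
  proof -
    have h: "k y x = cnj (k x y)" if "x \<in> M" for x using herm that y M by blast
    then have kyx: "k x y = 0 \<longleftrightarrow> k y x = 0" if "x \<in> M" for x using that by auto
    have fe: "f x y = inner (coord u y) (k y x * coord v x)" if "x \<in> M" for x
      using h[OF that] by (simp add: f_def inner_complex_def algebra_simps)
    have "(\<Sum>\<^sub>\<infinity>x\<in>M. f x y) = (\<Sum>\<^sub>\<infinity>x\<in>{x \<in> M. k y x \<noteq> 0}. f x y)"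
      by (rule infsum_cong_neutral) (auto simp: f0 kyx)
    also have "\<dots> = (\<Sum>x\<in>{x \<in> M. k y x \<noteq> 0}. inner (coord u y) (k y x * coord v x))"
      using kop_finite_row[OF M y] by (simp add: fe)
    also have "\<dots> = inner (coord u y) (coord (H M v) y)"
      by (simp add: coord_H_sum[OF M y] inner_sum_right)
    finally show ?thesis .
  qed
  have "inner (H M u) v = (\<Sum>\<^sub>\<infinity>x\<in>M. inner (coord (H M u) x) (coord v x))"
    unfolding inner_ell2_def by (rule infsum_cong_neutral) (auto simp: coord_H_outside[OF M])
  also have "\<dots> = (\<Sum>\<^sub>\<infinity>x\<in>M. \<Sum>\<^sub>\<infinity>y\<in>M. f x y)" by (rule infsum_cong) (simp add: row)
  also have "\<dots> = (\<Sum>\<^sub>\<infinity>y\<in>M. \<Sum>\<^sub>\<infinity>x\<in>M. f x y)" by (rule infsum_swap_banach[OF summ])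
  also have "\<dots> = (\<Sum>\<^sub>\<infinity>y\<in>M. inner (coord u y) (coord (H M v) y))" by (rule infsum_cong) (simp add: col)
  also have "\<dots> = inner u (H M v)"
    unfolding inner_ell2_def by (rule infsum_cong_neutral) (auto simp: coord_H_outside[OF M])
  finally show ?thesis .
qed

lemma coord_H_restrict:
  assumes "M \<subseteq> S" "u \<in> supported M" "x \<in> M"
  shows "coord (H M u) x = coord (H S u) x"
proof -
  have xS: "x \<in> S" using assms by auto
  show ?thesis
    unfolding coord_H_sum[OF assms(1,3)] coord_H_sum[OF order_refl xS]
    by (rule sum.mono_neutral_left) (use assms xS fin_row in \<open>auto simp: supported_def\<close>)
qed

text \<open>Since u vanishes off M, the entries of \<open>H S u\<close> off M do not enter the form;
  the forms of all compressions are restrictions of a single one.\<close>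

lemma inner_H_restrict:
  assumes "M \<subseteq> S" "u \<in> supported M"
  shows "inner (H M u) u = inner (H S u) u"
  unfolding inner_ell2_def
proof (rule infsum_cong)
  fix x
  show "inner (coord (H M u) x) (coord u x) = inner (coord (H S u) x) (coord u x)"
    using assms coord_H_restrict[OF assms, of x] by (cases "x \<in> M") (auto simp: supported_def)
qed

lemma shift_op_coord:
  assumes "M \<subseteq> S"
  shows "shift_op (kop k M) (of_real c) (coord u) = coord (H M u - c *\<^sub>R u)"
  using assms by (auto simp: shift_op_def coord_H scaleR_conv_of_real)

end

section \<open>The bottom of the spectrum and of the essential spectrum\<close>

lift_definition single :: "'a \<Rightarrow> complex \<Rightarrow> 'a ell2" is "\<lambda>i z j. if j = i then z else 0"
proof -
  fix i :: 'a and z :: complex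
  have "(\<lambda>j. (cmod (if j = i then z else 0))\<^sup>2) summable_on UNIV \<longleftrightarrow> (\<lambda>j. (cmod z)\<^sup>2) summable_on {i}"
    by (rule summable_on_cong_neutral) auto
  then show "(\<lambda>j. (cmod (if j = i then z else 0))\<^sup>2) summable_on UNIV" by simp
qed

lemma coord_single [simp]: "coord (single i z) j = (if j = i then z else 0)"
  by (simp add: single.rep_eq)

lemma norm_single: "norm (single i z) = cmod z"
proof -
  have "(norm (single i z))\<^sup>2 = (\<Sum>\<^sub>\<infinity>j\<in>{i}. (cmod z)\<^sup>2)"
    unfolding norm_ell2_sq by (rule infsum_cong_neutral) auto
  then show ?thesis by simp
qed

text \<open>Over the reals one complex coordinate adds two lines, in the directions
  \<open>single i 1\<close> and \<open>single i \<i>\<close>.\<close>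

lemma supported_insert:
  assumes "i \<notin> T"
  shows "supported (insert i T) =
    {y + t *\<^sub>R single i \<i> | y t. y \<in> {x + s *\<^sub>R single i 1 | x s. x \<in> supported T}}"
proof (intro equalityI subsetI)
  fix u assume u: "u \<in> supported (insert i T)"
  have "u - Re (coord u i) *\<^sub>R single i 1 - Im (coord u i) *\<^sub>R single i \<i> \<in> supported T"
    using u by (auto simp: supported_def complex_eq_iff)
  moreover have "u = (u - Re (coord u i) *\<^sub>R single i 1 - Im (coord u i) *\<^sub>R single i \<i>
      + Re (coord u i) *\<^sub>R single i 1) + Im (coord u i) *\<^sub>R single i \<i>" by simp
  ultimately show "u \<in> {y + t *\<^sub>R single i \<i> | y t. y \<in> {x + s *\<^sub>R single i 1 | x s. x \<in> supported T}}"
    by blast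
qed (auto simp: supported_def)

text \<open>Each new point enlarges the image by at most two real lines, and adding a line keeps a
  closed subspace closed. This extends closedness of the range from a cofinite set, where the
  operator is bounded below, to the whole of S.\<close>

lemma closed_image_supported_union_finite:
  fixes A :: "'a ell2 \<Rightarrow> 'a ell2"
  assumes "linear A" "closed (A ` supported T)" "finite F"
  shows "closed (A ` supported (T \<union> F))"
  using assms(3)
proof (induction F rule: finite_induct)
  case empty then show ?case using assms by simp
next
  case (insert i F)
  show ?case
  proof (cases "i \<in> T")
    case True then show ?thesis using insert by (simp add: insert_absorb)
  next
    case False
    define P where "P = {x + s *\<^sub>R single i 1 | x s. x \<in> supported (T \<union> F)}"
    have AP: "A ` P = {x + s *\<^sub>R A (single i 1) | x s. x \<in> A ` supported (T \<union> F)}"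
      unfolding P_def by (force simp: linear_add[OF assms(1)] linear_scale[OF assms(1)])
    have "subspace P"
    proof -
      have "P = {x + y |x y. x \<in> supported (T \<union> F) \<and> y \<in> span {single i 1}}"
        unfolding P_def span_singleton by auto
      then show ?thesis using subspace_sums[OF subspace_supported subspace_span] by auto
    qed
    then have sP: "subspace (A ` P)" by (rule linear_subspace_image[OF assms(1)])
    have "closed (A ` P)" unfolding AP
      by (rule closed_subspace_plus_line[OF linear_subspace_image[OF assms(1) subspace_supported] insert.IH])
    from closed_subspace_plus_line[OF sP this, of "A (single i \<i>)"]
    have "closed {x + t *\<^sub>R A (single i \<i>) | x t. x \<in> A ` P}" .
    also have "{x + t *\<^sub>R A (single i \<i>) | x t. x \<in> A ` P} = A ` {y + t *\<^sub>R single i \<i> | y t. y \<in> P}"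
      by (force simp: linear_add[OF assms(1)] linear_scale[OF assms(1)])
    also have "{y + t *\<^sub>R single i \<i> | y t. y \<in> P} = supported (T \<union> insert i F)"
      using supported_insert[of i "T \<union> F"] False insert.hyps unfolding P_def by simp
    finally show ?thesis .
  qed
qed

context hermitian_kernel
begin

definition shifted :: "'a set \<Rightarrow> real \<Rightarrow> 'a ell2 \<Rightarrow> 'a ell2" where
  "shifted M c u = H M u - c *\<^sub>R u"

lemma bounded_linear_shifted: "M \<subseteq> S \<Longrightarrow> bounded_linear (shifted M c)"
  unfolding shifted_def
  by (intro bounded_linear_sub bounded_linear_H bounded_linear_scaleR_right)

lemma linear_shifted: "M \<subseteq> S \<Longrightarrow> linear (shifted M c)"
  using bounded_linear_shifted bounded_linear.linear by blast

lemma norm_shifted_le: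
  assumes "M \<subseteq> S" shows "norm (shifted M c u) \<le> (N * C + \<bar>c\<bar>) * norm u"
  using norm_triangle_ineq4[of "H M u" "c *\<^sub>R u"] norm_H_le[OF assms, of u]
  by (simp add: shifted_def algebra_simps)

lemma shifted_symmetric: "M \<subseteq> S \<Longrightarrow> inner (shifted M c u) v = inner u (shifted M c v)"
  by (simp add: shifted_def inner_diff_left inner_diff_right H_symmetric)

lemma shifted_supported: "M \<subseteq> S \<Longrightarrow> u \<in> supported M \<Longrightarrow> shifted M c u \<in> supported M"
  unfolding shifted_def by (intro subspace_diff subspace_scale subspace_supported H_supported)

lemma inner_shifted_restrict:
  "M \<subseteq> S \<Longrightarrow> u \<in> supported M \<Longrightarrow> inner (shifted M c u) u = inner (shifted S c u) u"
  by (simp add: shifted_def inner_diff_left inner_H_restrict)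

lemma shifted_add_cscale:
  "M \<subseteq> S \<Longrightarrow> shifted M c (u + cscale z v) = shifted M c u + cscale z (shifted M c v)"
  by (rule ell2_eqI) (simp add: shifted_def H_add_cscale scaleR_conv_of_real algebra_simps)

lemma shift_op_image:
  "M \<subseteq> S \<Longrightarrow> shift_op (kop k M) (of_real c) ` l2 M = coord ` shifted M c ` supported M"
  by (force simp: l2_eq_coord_supported image_image shift_op_coord shifted_def)

lemma bij_betw_shift_op_iff:
  assumes M: "M \<subseteq> S"
  shows "bij_betw (shift_op (kop k M) (of_real c)) (l2 M) (l2 M) \<longleftrightarrow>
    bij_betw (shifted M c) (supported M) (supported M)"
proof -
  have inj: "inj coord" by (simp add: inj_on_def coord_inject)
  have "inj_on (shift_op (kop k M) (of_real c)) (l2 M) \<longleftrightarrow> inj_on (shifted M c) (supported M)"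
    unfolding l2_eq_coord_supported inj_on_def
    by (auto simp: shift_op_coord[OF M] coord_inject simp flip: shifted_def)
  moreover have "shift_op (kop k M) (of_real c) ` l2 M = l2 M \<longleftrightarrow>
      shifted M c ` supported M = supported M"
    unfolding shift_op_image[OF M] unfolding l2_eq_coord_supported by (rule inj_image_eq_iff[OF inj])
  ultimately show ?thesis by (simp add: bij_betw_def)
qed

section \<open>Infimum of the numerical range and minimum of the spectrum\<close>

definition lb :: "'a set \<Rightarrow> real" where
  "lb M = Inf ((\<lambda>u. inner (H M u) u) ` {u \<in> supported M. norm u = 1})"

lemma numerical_bounds:
  assumes "M \<subseteq> S" "norm u = 1"
  shows "- (N * C) \<le> inner (H M u) u" "inner (H M u) u \<le> N * C"
  using Cauchy_Schwarz_ineq2[of "H M u" u] norm_H_le[OF assms(1), of u] assms(2) by auto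

lemma bdd_below_numerical:
  "M \<subseteq> S \<Longrightarrow> bdd_below ((\<lambda>u. inner (H M u) u) ` {u \<in> supported M. norm u = 1})"
  using numerical_bounds(1) by (intro bdd_belowI[of _ "- (N * C)"]) auto

lemma lb_le:
  assumes M: "M \<subseteq> S" and u: "u \<in> supported M"
  shows "lb M * (norm u)\<^sup>2 \<le> inner (H M u) u"
proof (cases "u = 0")
  case True then show ?thesis by simp
next
  case False
  interpret H: bounded_linear "H M" by (rule bounded_linear_H[OF M])
  define v where "v = (1 / norm u) *\<^sub>R u"
  have v: "v \<in> supported M" "norm v = 1"
    using u False subspace_scale[OF subspace_supported] by (auto simp: v_def)
  have "lb M \<le> inner (H M v) v"
    unfolding lb_def by (rule cInf_lower) (use v bdd_below_numerical[OF M] in auto)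
  also have "\<dots> = inner (H M u) u / (norm u)\<^sup>2"
    by (simp add: v_def H.scaleR power2_eq_square)
  finally show ?thesis using False by (simp add: field_simps)
qed

lemma lb_approx:
  assumes M: "M \<subseteq> S" and "M \<noteq> {}" and e: "e > 0"
  obtains u where "u \<in> supported M" "norm u = 1" "inner (H M u) u < lb M + e"
proof -
  obtain i where i: "i \<in> M" using assms by blast
  have "single i 1 \<in> {u \<in> supported M. norm u = 1}" using i by (auto simp: supported_def norm_single)
  then have "(\<lambda>u. inner (H M u) u) ` {u \<in> supported M. norm u = 1} \<noteq> {}" by blast
  from cInf_lessD[OF this, of "lb M + e"] e that show ?thesis unfolding lb_def by auto
qed

lemma lb_upper:
  assumes "M \<subseteq> S" "M \<noteq> {}" shows "lb M \<le> N * C"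
proof -
  obtain u where u: "u \<in> supported M" "norm u = 1" using lb_approx[OF assms, of 1] by auto
  show ?thesis using lb_le[OF assms(1) u(1)] numerical_bounds(2)[OF assms(1) u(2)] u by simp
qed

lemma shifted_coercive:
  assumes "M \<subseteq> S" "u \<in> supported M"
  shows "(lb M - c) * (norm u)\<^sup>2 \<le> inner (shifted M c u) u"
  using lb_le[OF assms] by (simp add: shifted_def inner_diff_left algebra_simps power2_norm_eq_inner)

text \<open>Below \<open>lb M\<close> the shifted operator is coercive, hence bijective. At
  \<open>lb M\<close> it is nonnegative: bijectivity would bound it below in norm, while almost
  minimising unit vectors make its norm arbitrarily small.\<close>

lemma Inf_spectrum:
  assumes M: "M \<subseteq> S" and ne: "M \<noteq> {}"
  shows "Inf (real_part_set (spectrum_l2 M (kop k M))) = lb M"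
proof (rule cInf_eq_minimum)
  show "lb M \<le> c" if "c \<in> real_part_set (spectrum_l2 M (kop k M))" for c
  proof (rule ccontr)
    assume "\<not> lb M \<le> c"
    then have "bij_betw (shifted M c) (supported M) (supported M)"
      using shifted_supported[OF M]
      by (intro coercive_bij_betw[where e = "lb M - c"] subspace_supported closed_supported
          bounded_linear_shifted M shifted_coercive) auto
    with that show False
      by (simp add: real_part_set_def spectrum_l2_def bij_betw_shift_op_iff[OF M])
  qed
  show "lb M \<in> real_part_set (spectrum_l2 M (kop k M))"
  proof (rule ccontr)
    let ?B = "shifted M (lb M)"
    assume "lb M \<notin> real_part_set (spectrum_l2 M (kop k M))"
    then have bij: "bij_betw ?B (supported M) (supported M)"
      by (simp add: real_part_set_def spectrum_l2_def bij_betw_shift_op_iff[OF M])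
    have "\<exists>y. w = ?B y" if "w \<in> supported M" for w
      using that bij by (auto simp: bij_betw_def)
    then obtain c where c: "c > 0" "\<And>x. x \<in> supported M \<Longrightarrow> c * norm x \<le> norm (?B x)"
      using symmetric_bounded_below_on_closed_range[OF subspace_supported closed_supported
          linear_shifted[OF M] shifted_symmetric[OF M]] by metis
    define K where "K = N * C + \<bar>lb M\<bar> + 1"
    have K: "K > 0" using C_nonneg by (simp add: K_def add_nonneg_pos)
    have BK: "norm (?B u) \<le> K * norm u" for u
      using norm_shifted_le[OF M, of "lb M" u] mult_right_mono[of "N * C + \<bar>lb M\<bar>" K "norm u"]
      by (simp add: K_def)
    \<comment> \<open>A form value below \<open>c\<^sup>2 / K\<close> at a unit vector u pushes the
      norm of \<open>?B u\<close> under the lower bound c.\<close>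
    have "c\<^sup>2 / K > 0" using c K by simp
    then obtain u where u: "u \<in> supported M" "norm u = 1" "inner (H M u) u < lb M + c\<^sup>2 / K"
      using lb_approx[OF M ne] by blast
    have "(norm (?B u))\<^sup>2 \<le> K * inner (?B u) u"
    proof (rule nonneg_symmetric_norm_le[OF subspace_supported linear_shifted[OF M] shifted_symmetric[OF M] _ K BK u(1)])
      show "0 \<le> inner (?B x) x" if "x \<in> supported M" for x using shifted_coercive[OF M that, of "lb M"] by simp
    qed (rule shifted_supported[OF M u(1)])
    also have "inner (?B u) u < c\<^sup>2 / K"
      using u by (simp add: shifted_def inner_diff_left dot_square_norm)
    finally have "(norm (?B u))\<^sup>2 < c\<^sup>2" using K by (simp add: field_simps)
    moreover have "c\<^sup>2 \<le> (norm (?B u))\<^sup>2" using c(1) c(2)[OF u(1)] u(2) by (intro power_mono) auto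
    ultimately show False by simp
  qed
qed

text \<open>Coercivity bounds the operator below on \<open>supported M\<close>. Hence a kernel
  vector vanishing on the finite set \<open>S - M\<close> is zero, the range is a closed subspace
  extended by finitely many lines, and by symmetry the orthogonal complement of the range lies in
  the kernel.\<close>

lemma fredholm_below_lb:
  assumes M: "M \<subseteq> S" and fin: "finite (S - M)" and c: "c < lb M"
  shows "fredholm_l2 S (shift_op (kop k S) (of_real c))"
proof -
  let ?A = "shifted S c"
  have SS: "S \<subseteq> S" by simp
  have e: "lb M - c > 0" using c by simp
  have coer: "(lb M - c) * norm u \<le> norm (?A u)" if u: "u \<in> supported M" for u
  proof (cases "u = 0")
    case False
    have "(lb M - c) * (norm u)\<^sup>2 \<le> inner (?A u) u"
      using shifted_coercive[OF M u, of c] inner_shifted_restrict[OF M u] by simp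
    also have "\<dots> \<le> norm (?A u) * norm u" by (rule norm_cauchy_schwarz)
    finally show ?thesis using False by (simp add: power2_eq_square)
  qed simp
  have ker: "{u \<in> l2 S. shift_op (kop k S) (of_real c) u = (\<lambda>_. 0)} = coord ` {u \<in> supported S. ?A u = 0}"
  proof -
    have "coord (?A u) = (\<lambda>_. 0) \<longleftrightarrow> ?A u = 0" for u
      by (metis coord_inject coord_simps(1) ext)
    then show ?thesis
      unfolding l2_eq_coord_supported by (auto simp: shift_op_coord simp flip: shifted_def)
  qed
  have fd: "fin_dim (coord ` {u \<in> supported S. ?A u = 0})"
  proof (rule fin_dim_if_determined_by_finite_set[OF fin])
    fix v w z assume "v \<in> coord ` {u \<in> supported S. ?A u = 0}" "w \<in> coord ` {u \<in> supported S. ?A u = 0}"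
    then obtain v' w' where vw: "v = coord v'" "w = coord w'" "v' \<in> supported S" "w' \<in> supported S"
      "?A v' = 0" "?A w' = 0" by blast
    have "?A (v' + cscale z w') = 0" using vw by (simp add: shifted_add_cscale) (rule ell2_eqI, simp)
    moreover have "v' + cscale z w' \<in> supported S" using vw by (auto simp: supported_def)
    moreover have "(\<lambda>x. v x + z * w x) = coord (v' + cscale z w')" using vw by auto
    ultimately show "(\<lambda>x. v x + z * w x) \<in> coord ` {u \<in> supported S. ?A u = 0}" by blast
  next
    fix v assume "v \<in> coord ` {u \<in> supported S. ?A u = 0}" and 0: "\<And>x. x \<in> S - M \<Longrightarrow> v x = 0"
    then obtain u where u: "v = coord u" "u \<in> supported S" "?A u = 0" by blast
    have "u \<in> supported M" using u 0 by (auto simp: supported_def)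
    from coer[OF this] u e have "u = 0" by (simp add: mult_le_0_iff)
    then show "v = (\<lambda>_. 0)" using u by auto
  qed
  have "closed (?A ` supported M)"
  proof -
    have "complete (?A ` supported M)"
      using coer e by (intro complete_isometric_image[where e = "lb M - c"] subspace_supported bounded_linear_shifted)
        (auto simp: complete_eq_closed closed_supported)
    then show ?thesis by (rule complete_imp_closed)
  qed
  from closed_image_supported_union_finite[OF linear_shifted[OF SS] this fin]
  have clR: "closed (?A ` supported S)" using M by (simp add: Un_absorb1)
  show ?thesis
    unfolding fredholm_l2_def
  proof (intro conjI allI impI)
    show "fin_dim {u \<in> l2 S. shift_op (kop k S) (of_real c) u = (\<lambda>_. 0)}" using ker fd by simp
    fix v w
    assume vw: "(\<forall>n. v n \<in> shift_op (kop k S) (of_real c) ` l2 S) \<and> w \<in> l2 S \<and>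
            (\<lambda>n. l2norm S (\<lambda>x. v n x - w x)) \<longlonglongrightarrow> 0"
    then have v: "\<forall>n. \<exists>y\<in>?A ` supported S. v n = coord y" unfolding shift_op_image[OF SS] by blast
    from vw have w: "w \<in> coord ` supported S" unfolding l2_eq_coord_supported by blast
    from vw have lim: "(\<lambda>n. l2norm S (\<lambda>x. v n x - w x)) \<longlonglongrightarrow> 0" by blast
    obtain y where y: "\<And>n. y n \<in> ?A ` supported S" "\<And>n. v n = coord (y n)" using v by metis
    obtain w' where w': "w' \<in> supported S" "w = coord w'" using w by blast
    have "l2norm S (\<lambda>x. v n x - w x) = norm (y n - w')" for n
    proof -
      have "y n \<in> supported S" using y(1)[of n] shifted_supported[OF SS] by auto
      then have "y n - w' \<in> supported S" using w' subspace_diff[OF subspace_supported] by blast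
      from l2norm_coord[OF this] show ?thesis by (simp add: y w' minus_ell2.rep_eq)
    qed
    then have "y \<longlonglongrightarrow> w'" using lim by (simp add: LIM_zero_iff tendsto_norm_zero_iff)
    then have "w' \<in> ?A ` supported S" using closed_sequentially[OF clR] y by blast
    then show "w \<in> shift_op (kop k S) (of_real c) ` l2 S" using w' by (auto simp: shift_op_image)
  next
    have "{w \<in> l2 S. \<forall>v\<in>shift_op (kop k S) (of_real c) ` l2 S. l2inner S v w = 0}
        \<subseteq> coord ` {u \<in> supported S. ?A u = 0}"
    proof
      fix w assume w: "w \<in> {w \<in> l2 S. \<forall>v\<in>shift_op (kop k S) (of_real c) ` l2 S. l2inner S v w = 0}"
      then obtain w' where w': "w = coord w'" "w' \<in> supported S"
        unfolding l2_eq_coord_supported by blast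
      from w have orth: "l2inner S (coord (?A u)) (coord w') = 0" if "u \<in> supported S" for u
        using that unfolding shift_op_image[OF SS] w'(1) by blast
      have "inner (?A u) w' = 0" if "u \<in> supported S" for u
        using Re_l2inner_coord[OF shifted_supported[OF SS that], of c w'] orth[OF that] by simp
      \<comment> \<open>Orthogonality to \<open>?A (?A w')\<close> gives, by symmetry, that the
        squared norm of \<open>?A w'\<close> vanishes.\<close>
      from this[OF shifted_supported[OF SS w'(2), of c]] have "?A w' = 0"
        using shifted_symmetric[OF SS, of c "?A w'" w'] by simp
      with w' show "w \<in> coord ` {u \<in> supported S. ?A u = 0}" by blast
    qed
    then show "fin_dim {w \<in> l2 S. \<forall>v\<in>shift_op (kop k S) (of_real c) ` l2 S. l2inner S v w = 0}"
      using fd by (rule fin_dim_mono)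
  qed
qed

text \<open>On the finite-dimensional kernel the norm is controlled by the values on some finite set
  \<open>G\<close>. For \<open>u\<close> vanishing on \<open>G\<close>, the kernel component of \<open>u\<close> is therefore controlled by its
  projection onto the closed range, where the operator is bounded below.\<close>
lemma not_fredholm_if_weyl:
  assumes weyl: "\<And>F e. finite F \<Longrightarrow> e > 0 \<Longrightarrow>
    \<exists>u\<in>supported (S - F). norm u = 1 \<and> norm (shifted S c u) \<le> e"
  shows "\<not> fredholm_l2 S (shift_op (kop k S) (of_real c))"
proof
  let ?A = "shifted S c"
  have SS: "S \<subseteq> S" by simp
  assume fred: "fredholm_l2 S (shift_op (kop k S) (of_real c))"
  define V where "V = {u \<in> supported S. ?A u = 0}"
  define R where "R = ?A ` supported S"
  have RS: "R \<subseteq> supported S" using shifted_supported[OF SS] by (auto simp: R_def)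
  have subR: "subspace R" unfolding R_def
    by (rule linear_subspace_image[OF linear_shifted[OF SS] subspace_supported])
  have "closed R"
    unfolding closed_sequential_limits
  proof (intro allI impI)
    fix y l assume yl: "(\<forall>n. y n \<in> R) \<and> y \<longlonglongrightarrow> l"
    then have l: "l \<in> supported S" using closed_sequentially[OF closed_supported] RS by blast
    have "l2norm S (\<lambda>x. coord (y n) x - coord l x) = norm (y n - l)" for n
    proof -
      have "y n - l \<in> supported S" using yl RS l subspace_diff[OF subspace_supported] by blast
      from l2norm_coord[OF this] show ?thesis by (simp add: minus_ell2.rep_eq)
    qed
    moreover have "(\<lambda>n. norm (y n - l)) \<longlonglongrightarrow> 0" using yl by (simp add: LIM_zero_iff tendsto_norm_zero_iff)
    ultimately have "(\<lambda>n. l2norm S (\<lambda>x. coord (y n) x - coord l x)) \<longlonglongrightarrow> 0" by simp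
    moreover have "coord (y n) \<in> shift_op (kop k S) (of_real c) ` l2 S" for n
      using yl by (auto simp: shift_op_image R_def)
    moreover have "coord l \<in> l2 S" using l by (auto simp: l2_eq_coord_supported)
    moreover have "\<forall>v w. (\<forall>n. v n \<in> shift_op (kop k S) (of_real c) ` l2 S) \<and> w \<in> l2 S \<and>
        (\<lambda>n. l2norm S (\<lambda>x. v n x - w x)) \<longlonglongrightarrow> 0 \<longrightarrow> w \<in> shift_op (kop k S) (of_real c) ` l2 S"
      using fred unfolding fredholm_l2_def by (elim conjE)
    note this[rule_format, of "\<lambda>n. coord (y n)" "coord l"]
    ultimately have "coord l \<in> shift_op (kop k S) (of_real c) ` l2 S" by blast
    then show "l \<in> R" by (auto simp: shift_op_image R_def coord_inject)
  qed
  have "coord ` V \<subseteq> {u \<in> l2 S. shift_op (kop k S) (of_real c) u = (\<lambda>_. 0)}"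
    unfolding V_def l2_eq_coord_supported by (auto simp: shift_op_coord simp flip: shifted_def)
  then have fdV: "fin_dim (coord ` V)" using fred fin_dim_mono unfolding fredholm_l2_def by blast
  have "v + cscale z w \<in> V" if "v \<in> V" "w \<in> V" for v w z
  proof -
    have "?A (v + cscale z w) = 0" using that by (simp add: V_def shifted_add_cscale) (rule ell2_eqI, simp)
    then show ?thesis using that by (auto simp: V_def supported_def)
  qed
  then obtain G B where G: "finite G" "B \<ge> 0" "\<And>v. v \<in> V \<Longrightarrow> norm v \<le> B * (\<Sum>x\<in>G. cmod (coord v x))"
    using fin_dim_norm_le_sum_on_finite_set[OF fdV] by blast
  obtain b where b: "b > 0" "\<And>x. x \<in> R \<Longrightarrow> b * norm x \<le> norm (?A x)"
    using symmetric_bounded_below_on_closed_range[OF subR \<open>closed R\<close> linear_shifted[OF SS] shifted_symmetric[OF SS]]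
    unfolding R_def by (metis imageE)
  \<comment> \<open>The decomposition u = p + q will give 1 = norm u at most D times norm p, and the
    threshold \<open>b / (2 * D)\<close> forces norm p to be at most 1/(2D): a
    contradiction.\<close>
  define D where "D = 1 + B * card G"
  have D: "D \<ge> 1" using G by (simp add: D_def)
  obtain u where u: "u \<in> supported (S - G)" "norm u = 1" "norm (?A u) \<le> b / (2 * D)"
    using weyl[OF G(1), of "b / (2 * D)"] b D by auto
  obtain p where p: "p \<in> R" "\<And>w. w \<in> R \<Longrightarrow> inner (u - p) w = 0"
    using orthogonal_projection_exists[OF subR \<open>closed R\<close>] by blast
  define q where "q = u - p"
  have uS: "u \<in> supported S" using u(1) supported_mono[of "S - G" S] by blast
  have qS: "q \<in> supported S" unfolding q_def
    using uS p RS subspace_diff[OF subspace_supported] by blast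
  \<comment> \<open>The residual q is orthogonal to R, which contains \<open>?A (?A q)\<close>;
    hence q lies in the kernel.\<close>
  have "inner (?A q) (?A q) = inner q (?A (?A q))" by (rule shifted_symmetric) simp
  also have "\<dots> = 0" unfolding q_def[symmetric] using p(2)[of "?A (?A q)"] shifted_supported[OF SS qS]
    by (simp add: R_def q_def)
  finally have Aq: "?A q = 0" by simp
  then have "q \<in> V" using qS by (simp add: V_def)
  have "?A p = ?A u" using Aq by (simp add: q_def linear_diff[OF linear_shifted[OF SS]])
  then have "b * norm p \<le> b * (1 / (2 * D))" using b(2)[OF p(1)] u(3) by simp
  then have np: "norm p \<le> 1 / (2 * D)" using b(1) by (rule mult_left_le_imp_le)
  have "cmod (coord q x) \<le> norm p" if "x \<in> G" for x
  proof -
    have "coord u x = 0" using u(1) that by (auto simp: supported_def)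
    then have "coord q x = - coord p x" by (simp add: q_def)
    then show ?thesis using cmod_coord_le_norm[of p x] by simp
  qed
  then have "(\<Sum>x\<in>G. cmod (coord q x)) \<le> card G * norm p"
    using sum_bounded_above[of G "\<lambda>x. cmod (coord q x)"] by simp
  then have "norm q \<le> B * (card G * norm p)"
    using G(3)[OF \<open>q \<in> V\<close>] mult_left_mono[OF _ G(2)] by (meson order_trans)
  moreover have "norm u \<le> norm p + norm q"
    using norm_triangle_ineq[of p q] by (simp add: q_def)
  ultimately have "1 \<le> D * norm p" using u(2) by (simp add: D_def algebra_simps)
  also have "\<dots> \<le> D * (1 / (2 * D))" using np D by (intro mult_left_mono) auto
  also have "\<dots> = 1 / 2" using D by simp
  finally show False by simp
qed

text \<open>The supremum l may fail to be attained, but each c < l lies below some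
  \<open>lb M\<close>, and cofiniteness of that M yields the Fredholm property at c. Avoidance of
  finite sets supplies the Weyl vectors at l.\<close>

theorem Inf_ess_spectrum_eq_SUP:
  assumes sub: "\<And>M. M \<in> \<M> \<Longrightarrow> M \<subseteq> S" and ne: "\<And>M. M \<in> \<M> \<Longrightarrow> M \<noteq> {}"
    and cofin: "\<And>M. M \<in> \<M> \<Longrightarrow> finite (S - M)"
    and avoid: "\<And>F. finite F \<Longrightarrow> F \<subseteq> S \<Longrightarrow> \<exists>M\<in>\<M>. M \<inter> F = {}"
  shows "Inf (real_part_set (ess_spectrum_l2 S (kop k S))) =
    (SUP M\<in>\<M>. Inf (real_part_set (spectrum_l2 M (kop k M))))"
proof -
  define l where "l = (SUP M\<in>\<M>. lb M)"
  have SS: "S \<subseteq> S" by simp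
  have M0: "\<M> \<noteq> {}" using avoid[of "{}"] by auto
  have bdd: "bdd_above (lb ` \<M>)" by (rule bdd_aboveI2[of _ _ "N * C"]) (use lb_upper sub ne in auto)
  have lb_l: "lb M \<le> l" if "M \<in> \<M>" for M unfolding l_def by (rule cSUP_upper[OF that bdd])
  have "(SUP M\<in>\<M>. Inf (real_part_set (spectrum_l2 M (kop k M)))) = l"
    unfolding l_def by (rule SUP_cong) (use Inf_spectrum sub ne in auto)
  moreover have "Inf (real_part_set (ess_spectrum_l2 S (kop k S))) = l"
  proof (rule cInf_eq_minimum)
    show "l \<le> c" if "c \<in> real_part_set (ess_spectrum_l2 S (kop k S))" for c
    proof (rule ccontr)
      assume "\<not> l \<le> c"
      then have "c < l" by simp
      then obtain M where "M \<in> \<M>" "c < lb M" unfolding l_def less_cSUP_iff[OF M0 bdd] by auto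
      then show False
        using that fredholm_below_lb[OF sub cofin] by (simp add: real_part_set_def ess_spectrum_l2_def)
    qed
    have "\<not> fredholm_l2 S (shift_op (kop k S) (of_real l))"
    proof (rule not_fredholm_if_weyl)
      fix F :: "'a set" and e :: real assume F: "finite F" and e: "e > 0"
      define K where "K = N * C + \<bar>l\<bar> + 2"
      have K: "K \<ge> 2" using C_nonneg by (simp add: K_def)
      \<comment> \<open>The estimates end with the squared norm of \<open>?B u\<close> at most
        2*K*d, and an error d from the shift. The last two bounds make each contribution at most
        e/2, and d \<le> 1 keeps the norm bound of the shifted operator within K.\<close>
      define d where "d = min 1 (min (e / 2) (e\<^sup>2 / (8 * K)))"
      have d: "d > 0" "d \<le> 1" "d \<le> e / 2" "d \<le> e\<^sup>2 / (8 * K)" using e K by (auto simp: d_def)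
      have "l - d < l" using d by simp
      then obtain M1 where M1: "M1 \<in> \<M>" "l - d < lb M1"
        unfolding l_def using less_cSUP_iff[OF M0 bdd] by auto
      note M1S = sub[OF M1(1)]
      \<comment> \<open>Avoiding F1 places M2 outside F and inside M1, and away from every point
        coupled by k to \<open>S - M1\<close>.\<close>
      define F1 where "F1 = (F \<inter> S) \<union> (S - M1) \<union> (\<Union>x\<in>S - M1. {y \<in> S. k x y \<noteq> 0})"
      have "finite F1" "F1 \<subseteq> S" unfolding F1_def using F cofin[OF M1(1)] fin_row by auto
      then obtain M2 where M2: "M2 \<in> \<M>" "M2 \<inter> F1 = {}" using avoid by blast
      note M2S = sub[OF M2(1)]
      have M21: "M2 \<subseteq> M1" using M2 M2S by (auto simp: F1_def)
      obtain u where u: "u \<in> supported M2" "norm u = 1" "inner (H M2 u) u < lb M2 + d"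
        using lb_approx[OF M2S ne[OF M2(1)] d(1)] by blast
      have u1: "u \<in> supported M1" using u M21 supported_mono by blast
      \<comment> \<open>The shift lies below \<open>lb M1\<close>, so \<open>?B\<close> is
        nonnegative on \<open>supported M1\<close>. The form of u is less than d above
        \<open>lb M2\<close>, which is at most l, and this accounts for the bound 2*d.\<close>
      let ?B = "shifted M1 (l - d)"
      have Bu: "inner (?B u) u \<le> 2 * d"
      proof -
        have "inner (H M1 u) u = inner (H M2 u) u"
          using inner_H_restrict[OF M1S u1] inner_H_restrict[OF M2S u(1)] by simp
        then show ?thesis
          using u lb_l[OF M2(1)] by (simp add: shifted_def inner_diff_left dot_square_norm)
      qed
      have BK: "norm (?B v) \<le> K * norm v" for v
      proof -
        have "N * C + \<bar>l - d\<bar> \<le> K" using d by (simp add: K_def)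
        then show ?thesis
          using norm_shifted_le[OF M1S, of "l - d" v] mult_right_mono[of "N * C + \<bar>l - d\<bar>" K "norm v"] by simp
      qed
      have "(norm (?B u))\<^sup>2 \<le> K * inner (?B u) u"
      proof (rule nonneg_symmetric_norm_le[OF subspace_supported linear_shifted[OF M1S] shifted_symmetric[OF M1S] _ _ BK u1])
        show "0 \<le> inner (?B x) x" if "x \<in> supported M1" for x
          using shifted_coercive[OF M1S that, of "l - d"] M1(2)
          by (meson diff_ge_0_iff_ge less_imp_le mult_nonneg_nonneg order_trans zero_le_power2)
      qed (use K shifted_supported[OF M1S u1] in auto)
      also have "\<dots> \<le> K * (2 * d)" using Bu K by (intro mult_left_mono) auto
      also have "\<dots> \<le> (e / 2)\<^sup>2" using d(4) K by (simp add: field_simps power2_eq_square)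
      finally have nB: "norm (?B u) \<le> e / 2" by (rule power2_le_imp_le) (use e in simp)
      \<comment> \<open>Off M1 the full operator gives 0 as well: a row in \<open>S - M1\<close>
        couples only to points of F1, where u vanishes.\<close>
      have "coord (H S u) x = coord (H M1 u) x" for x
      proof (cases "x \<in> M1")
        case True then show ?thesis using coord_H_restrict[OF M1S u1] by simp
      next
        case False
        have "coord (H S u) x = 0"
        proof (cases "x \<in> S")
          case True
          have "coord u y = 0" if "y \<in> S" "k x y \<noteq> 0" for y
            using u(1) that True False M2(2) unfolding supported_def F1_def by auto
          then show ?thesis unfolding coord_H_sum[OF SS True] by (intro sum.neutral) auto
        qed (simp add: coord_H_outside)
        then show ?thesis using False by (simp add: coord_H_outside[OF M1S])
      qed
      then have "H S u = H M1 u" by (rule ell2_eqI)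
      then have "shifted S l u = ?B u - d *\<^sub>R u" by (simp add: shifted_def algebra_simps)
      then have "norm (shifted S l u) \<le> e"
        using norm_triangle_ineq4[of "?B u" "d *\<^sub>R u"] nB d u(2) by simp
      moreover have "u \<in> supported (S - F)"
        using u(1) M2(2) M2S by (auto simp: supported_def F1_def)
      ultimately show "\<exists>u\<in>supported (S - F). norm u = 1 \<and> norm (shifted S l u) \<le> e" using u(2) by blast
    qed
    then show "l \<in> real_part_set (ess_spectrum_l2 S (kop k S))"
      by (simp add: real_part_set_def ess_spectrum_l2_def)
  qed
  ultimately show ?thesis by simp
qed

end

section \<open>Standard groupoids\<close>

text \<open>Local injectivity makes the fibre discrete, and a discrete second countable space is
  countable.\<close>

lemma second_countable_imp_countable_fibre:
  fixes f :: "'g::topological_space \<Rightarrow> 'b"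
  assumes sc: "second_countable (top_of_set Z)"
    and loc: "\<And>\<xi>. \<exists>U. open U \<and> \<xi> \<in> U \<and> inj_on f U"
  shows "countable {\<xi> \<in> Z. f \<xi> = x}"
proof -
  define Y where "Y = {\<xi> \<in> Z. f \<xi> = x}"
  have sub: "subtopology (top_of_set Z) Y = top_of_set Y"
    by (simp add: subtopology_subtopology Y_def inf_absorb2 Collect_restrict)
  have "openin (top_of_set Y) {\<xi>}" if "\<xi> \<in> Y" for \<xi>
  proof -
    obtain U where U: "open U" "\<xi> \<in> U" "inj_on f U" using loc by blast
    have "{\<xi>} = Y \<inter> U" using that U by (auto simp: Y_def inj_on_def)
    then show ?thesis using U by (metis openin_open)
  qed
  then have "top_of_set Y = discrete_topology Y"
    by (metis discrete_topology_unique topspace_euclidean_subtopology)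
  moreover have "second_countable (top_of_set Y)" using second_countable_subtopology[OF sc, of Y] sub by simp
  ultimately show ?thesis by (simp add: second_countable_discrete_topology Y_def)
qed

lemma Hausdorff_space_top_of_set: "Hausdorff_space (top_of_set (A :: 'a::t2_space set))"
proof (rule Hausdorff_space_subtopology)
  show "Hausdorff_space (euclidean :: 'a topology)"
    unfolding Hausdorff_space_def disjnt_def using hausdorff by (auto simp: disjoint_iff)
qed

text \<open>Baire: if no point were open, the closed singletons would be nowhere dense, and their
  countable union, the whole space, would have empty interior.\<close>

lemma countable_locally_compact_has_isolated_point:
  assumes lc: "locally_compact_space X" and Hd: "Hausdorff_space X" and "countable (topspace X)"
    and "topspace X \<noteq> {}"
  obtains x where "x \<in> topspace X" "openin X {x}"
proof (rule ccontr)
  assume "\<not> thesis"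
  with that have no: "\<And>x. x \<in> topspace X \<Longrightarrow> \<not> openin X {x}" by blast
  have "X interior_of \<Union>((\<lambda>x. {x}) ` topspace X) = {}"
  proof (rule Baire_category_alt)
    show "completely_metrizable_space X \<or> locally_compact_space X \<and> regular_space X"
      using lc Hd locally_compact_Hausdorff_imp_regular_space by blast
    show "closedin X T \<and> X interior_of T = {}" if T: "T \<in> (\<lambda>x. {x}) ` topspace X" for T
    proof -
      obtain x where x: "x \<in> topspace X" "T = {x}" using T by blast
      have "X interior_of {x} = {}"
      proof (rule ccontr)
        assume "X interior_of {x} \<noteq> {}"
        then have "X interior_of {x} = {x}" using interior_of_subset[of X "{x}"] by blast
        then have "openin X {x}" using openin_interior_of[of X "{x}"] by simp
        with no[OF x(1)] show False by blast
      qed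
      then show ?thesis using x Hd by (simp add: closedin_Hausdorff_singleton)
    qed
  qed (use assms in auto)
  then show False using assms(4) by (simp add: interior_of_topspace)
qed

text \<open>Each point has an open set meeting X only there, and finitely many of these cover K.
  This turns relative compactness in the main orbit into finiteness.\<close>

lemma compact_subset_of_isolated_points_finite:
  assumes "compact K" "K \<subseteq> X" "\<And>x. x \<in> K \<Longrightarrow> openin (top_of_set X) {x}"
  shows "finite K"
proof -
  have "\<exists>U. open U \<and> X \<inter> U = {x}" if "x \<in> K" for x using assms(3)[OF that] by (metis openin_open)
  then obtain U where U: "\<And>x. x \<in> K \<Longrightarrow> open (U x)" "\<And>x. x \<in> K \<Longrightarrow> X \<inter> U x = {x}" by metis
  have "K \<subseteq> (\<Union>x\<in>K. U x)" using U(2) by blast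
  then obtain F where F: "F \<subseteq> K" "finite F" "K \<subseteq> (\<Union>x\<in>F. U x)"
    using compactE_image[OF assms(1), of K U] U(1) by blast
  have "K \<subseteq> F"
  proof
    fix y assume "y \<in> K"
    then obtain x where x: "x \<in> F" "y \<in> U x" using F by blast
    then have "y \<in> X \<inter> U x" using \<open>y \<in> K\<close> assms(2) by blast
    moreover have "X \<inter> U x = {x}" using x F(1) by (intro U(2)) blast
    ultimately show "y \<in> F" using x(1) by simp
  qed
  then show ?thesis using F finite_subset by blast
qed

lemma local_homeo_onto_inj:
  assumes "local_homeo_onto f Y" shows "\<exists>U. open U \<and> \<xi> \<in> U \<and> inj_on f U"
proof -
  obtain U g where U: "open U" "\<xi> \<in> U" "homeomorphism U (f ` U) f g"
    using assms unfolding local_homeo_onto_def by blast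
  then have "inj_on f U" by (metis homeomorphism_apply1 inj_onI)
  then show ?thesis using U by blast
qed

text \<open>Together with its counterpart for images, this carries isolatedness along an arrow, from
  \<open>d \<xi>\<close> to \<xi> and on to \<open>r \<xi>\<close>.\<close>

lemma open_singleton_if_image_isolated:
  assumes f: "local_homeo_onto f Y" and y: "openin (top_of_set Y) {f \<xi>}"
  shows "open {\<xi>}"
proof -
  obtain U g where U: "open U" "\<xi> \<in> U" "homeomorphism U (f ` U) f g"
    using f unfolding local_homeo_onto_def by blast
  have cont: "continuous_on U f" using U(3) by (simp add: homeomorphism_def)
  have "f ` U \<subseteq> Y" using f by (auto simp: local_homeo_onto_def)
  then have "openin (top_of_set (f ` U)) {f \<xi>}"
    using y U(2) openin_subset_trans[of Y "{f \<xi>}" "f ` U"] by blast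
  then have "openin (top_of_set U) (U \<inter> f -` {f \<xi>})" by (rule continuous_on_open[THEN iffD1, rule_format, OF cont])
  moreover have "U \<inter> f -` {f \<xi>} = {\<xi>}"
    using U by (auto simp: homeomorphism_def) metis
  ultimately show ?thesis using U(1) by (metis openin_open_eq)
qed

lemma image_isolated_if_open_singleton:
  assumes f: "local_homeo_onto f Y" and "open {\<xi>}"
  shows "openin (top_of_set Y) {f \<xi>}"
proof -
  obtain U g where U: "open U" "\<xi> \<in> U" "openin (top_of_set Y) (f ` U)" "homeomorphism U (f ` U) f g"
    using f unfolding local_homeo_onto_def by blast
  have "openin (top_of_set U) {\<xi>}" using assms(2) U by (simp add: openin_open_eq)
  then have "openin (top_of_set (f ` U)) (f ` {\<xi>})"
    using U(4) homeomorphism_imp_open_map by blast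
  then show ?thesis using U(3) openin_trans by fastforce
qed

lemma bounded_if_Cc: assumes "Cc h" obtains B where "\<And>\<xi>. norm (h \<xi>) \<le> B" "B \<ge> 0"
proof -
  have "compact (h ` closure {\<xi>. h \<xi> \<noteq> 0})"
    using assms unfolding Cc_def by (metis compact_continuous_image continuous_on_subset subset_UNIV)
  then obtain B where B: "\<And>\<xi>. \<xi> \<in> closure {\<xi>. h \<xi> \<noteq> 0} \<Longrightarrow> norm (h \<xi>) \<le> B"
    using compact_imp_bounded bounded_iff by (metis imageI)
  have "norm (h \<xi>) \<le> max B 0" for \<xi>
    using B[of \<xi>] closure_subset[of "{\<xi>. h \<xi> \<noteq> 0}"] by (cases "h \<xi> = 0") auto
  then show ?thesis using that by (meson max.cobounded2)
qed

text \<open>The compact support is covered by finitely many open sets on which f is injective. A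
  fibre meets each of them at most once, so their number serves as N.\<close>

lemma Cc_fibre_card_bounded:
  fixes h :: "'g::topological_space \<Rightarrow> complex"
  assumes "Cc h" and loc: "\<And>\<xi>. \<exists>U. open U \<and> \<xi> \<in> U \<and> inj_on f U"
  obtains N where "\<And>x. finite {\<xi>. f \<xi> = x \<and> h \<xi> \<noteq> 0}" "\<And>x. card {\<xi>. f \<xi> = x \<and> h \<xi> \<noteq> 0} \<le> N"
proof -
  let ?K = "closure {\<xi>. h \<xi> \<noteq> 0}"
  obtain U where U: "\<And>\<xi>. open (U \<xi>)" "\<And>\<xi>. \<xi> \<in> U \<xi>" "\<And>\<xi>. inj_on f (U \<xi>)" using loc by metis
  have K: "compact ?K" using assms by (simp add: Cc_def)
  have "?K \<subseteq> (\<Union>\<xi>\<in>?K. U \<xi>)" using U(2) by blast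
  then obtain F where "F \<subseteq> ?K" and F: "finite F" "?K \<subseteq> (\<Union>\<xi>\<in>F. U \<xi>)"
    by (rule compactE_image[OF K U(1)])
  \<comment> \<open>A set that misses the fibre contributes an arbitrary value of THE, which is
    harmless for an inclusion.\<close>
  have sub: "{\<xi>. f \<xi> = x \<and> h \<xi> \<noteq> 0} \<subseteq> (\<lambda>\<eta>. THE \<xi>. \<xi> \<in> U \<eta> \<and> f \<xi> = x) ` F" for x
  proof
    fix \<xi> assume xi: "\<xi> \<in> {\<xi>. f \<xi> = x \<and> h \<xi> \<noteq> 0}"
    then obtain \<eta> where e: "\<eta> \<in> F" "\<xi> \<in> U \<eta>" using F closure_subset[of "{\<xi>. h \<xi> \<noteq> 0}"] by blast
    have "(THE \<xi>. \<xi> \<in> U \<eta> \<and> f \<xi> = x) = \<xi>"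
      using e xi U(3)[of \<eta>] by (intro the_equality) (auto simp: inj_on_def)
    then show "\<xi> \<in> (\<lambda>\<eta>. THE \<xi>. \<xi> \<in> U \<eta> \<and> f \<xi> = x) ` F" using e by force
  qed
  show ?thesis
  proof (rule that[of "card F"])
    show "finite {\<xi>. f \<xi> = x \<and> h \<xi> \<noteq> 0}" for x using sub F(1) finite_subset by blast
    show "card {\<xi>. f \<xi> = x \<and> h \<xi> \<noteq> 0} \<le> card F" for x
      using surj_card_le[OF F(1) sub] .
  qed
qed

text \<open>The product \<open>mul (iv \<xi>) \<eta>\<close> has range and domain
  \<open>d \<xi>\<close>, hence is a unit; multiplying it by \<xi> from the left recovers
  \<eta>.\<close>

lemma groupoid_eq_if_trivial_isotropy:
  assumes G: "groupoid r d mul iv"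
    and triv: "\<And>\<xi>. r \<xi> \<in> Z \<Longrightarrow> d \<xi> = r \<xi> \<Longrightarrow> \<xi> = r \<xi>"
    and "r \<xi> = r \<eta>" "d \<xi> = d \<eta>" "d \<xi> \<in> Z"
  shows "\<xi> = \<eta>"
proof -
  have inv: "r (iv \<xi>) = d \<xi>" "d (iv \<xi>) = r \<xi>" "mul \<xi> (iv \<xi>) = r \<xi>" using G by (auto simp: groupoid_def)
  have rd: "r (mul (iv \<xi>) \<eta>) = d \<xi>" "d (mul (iv \<xi>) \<eta>) = d \<eta>"
    using G inv assms(3) unfolding groupoid_def by auto
  then have u: "mul (iv \<xi>) \<eta> = d \<xi>" using triv[of "mul (iv \<xi>) \<eta>"] assms by simp
  have "\<eta> = mul (r \<eta>) \<eta>" using G by (simp add: groupoid_def)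
  also have "\<dots> = mul (mul \<xi> (iv \<xi>)) \<eta>" using inv assms by simp
  also have "\<dots> = mul \<xi> (mul (iv \<xi>) \<eta>)" using G inv assms(3) unfolding groupoid_def by metis
  also have "\<dots> = \<xi>" unfolding u using G by (simp add: groupoid_def)
  finally show ?thesis ..
qed

lemma standard_main_orbit_isolated:
  assumes std: "standard_manageable r d mul iv Xinf" and y: "y \<in> unit_space r - Xinf"
  shows "openin (top_of_set (unit_space r)) {y}"
proof -
  define X0 where "X0 = unit_space r - Xinf"
  have man: "manageable r d mul iv" and Xc: "closed Xinf"
    and orb: "\<And>x y. x \<in> X0 \<Longrightarrow> y \<in> X0 \<Longrightarrow> \<exists>\<xi>. r \<xi> = x \<and> d \<xi> = y"
    and sc: "second_countable (top_of_set {\<xi>. r \<xi> \<in> X0 \<and> d \<xi> \<in> X0})" and ne: "X0 \<noteq> {}"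
    using std unfolding standard_manageable_def Let_def X0_def by auto
  have X: "compact (unit_space r)" and lr: "local_homeo_onto r (unit_space r)"
    and ld: "local_homeo_onto d (unit_space r)"
    using man unfolding manageable_def etale_def by auto
  obtain z where z: "z \<in> X0" using ne by blast
  \<comment> \<open>Openness of X0 in the unit space passes local compactness to X0 and makes points
    isolated in X0 isolated in the whole unit space.\<close>
  have op: "openin (top_of_set (unit_space r)) X0"
    unfolding X0_def using Xc by (metis Diff_eq open_Compl openin_open)
  have "countable {\<xi> \<in> {\<xi>. r \<xi> \<in> X0 \<and> d \<xi> \<in> X0}. r \<xi> = z}"
    by (rule second_countable_imp_countable_fibre[OF sc]) (rule local_homeo_onto_inj[OF lr])
  moreover have "X0 \<subseteq> d ` {\<xi> \<in> {\<xi>. r \<xi> \<in> X0 \<and> d \<xi> \<in> X0}. r \<xi> = z}" using orb[OF z] z by blast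
  ultimately have cX0: "countable X0" by (meson countable_image countable_subset)
  have "locally_compact_space (top_of_set (unit_space r))"
    using X by (simp add: compact_imp_locally_compact_space compact_space_subtopology)
  then have "locally_compact_space (subtopology (top_of_set (unit_space r)) X0)"
    by (rule locally_compact_space_open_subset[OF disjI1[OF Hausdorff_space_top_of_set] _ op])
  moreover have "subtopology (top_of_set (unit_space r)) X0 = top_of_set X0"
    by (simp add: subtopology_subtopology X0_def Int_absorb1 Diff_subset)
  ultimately have lc: "locally_compact_space (top_of_set X0)" by simp
  obtain x where x: "x \<in> X0" "openin (top_of_set X0) {x}"
    using countable_locally_compact_has_isolated_point[OF lc] cX0 ne
    by (auto simp: Hausdorff_space_top_of_set)
  obtain \<xi> where xi: "r \<xi> = y" "d \<xi> = x" using orb x y X0_def by blast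
  have "openin (top_of_set (unit_space r)) {d \<xi>}" using x op xi openin_trans by blast
  from image_isolated_if_open_singleton[OF lr open_singleton_if_image_isolated[OF ld this]]
  show ?thesis using xi by simp
qed

section \<open>Reversing the sign of the kernel, which exchanges infima and suprema\<close>

lemma kernel_op_eq_kop: "kernel_op r d h S = kop (\<lambda>x y. h (theta r d x y)) S"
  by (simp add: kernel_op_def kop_def fun_eq_iff)

lemma kop_uminus: "kop (\<lambda>x y. - k x y) M u = (\<lambda>x. - kop k M u x)"
  by (auto simp: kop_def infsum_uminus)

lemma kop_uminus_arg: "kop k M (\<lambda>x. - u x) = (\<lambda>x. - kop k M u x)"
  by (auto simp: kop_def infsum_uminus)

lemma l2_uminus: "u \<in> l2 M \<Longrightarrow> (\<lambda>x. - u x) \<in> l2 M"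
  by (auto simp: l2_def)

lemma shift_op_kop_uminus:
  "shift_op (kop (\<lambda>x y. - k x y) M) c u = (\<lambda>x. - shift_op (kop k M) (- c) u x)"
  by (auto simp: shift_op_def kop_uminus)

text \<open>With the sign on the argument the two operators visibly have the same range, as
  \<open>l2 M\<close> is closed under negation. The form with the outer sign serves kernels and
  injectivity.\<close>

lemma shift_op_kop_uminus_arg:
  "shift_op (kop (\<lambda>x y. - k x y) M) c u = shift_op (kop k M) (- c) (\<lambda>x. - u x)"
  by (auto simp: shift_op_def kop_uminus kop_uminus_arg)

lemma shift_op_kop_uminus_image:
  "shift_op (kop (\<lambda>x y. - k x y) M) c ` l2 M = shift_op (kop k M) (- c) ` l2 M"
proof (intro equalityI subsetI)
  fix w assume "w \<in> shift_op (kop (\<lambda>x y. - k x y) M) c ` l2 M"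
  then show "w \<in> shift_op (kop k M) (- c) ` l2 M"
    unfolding shift_op_kop_uminus_arg using l2_uminus by blast
next
  fix w assume "w \<in> shift_op (kop k M) (- c) ` l2 M"
  then obtain u where u: "u \<in> l2 M" "w = shift_op (kop k M) (- c) u" by blast
  then have "w = shift_op (kop (\<lambda>x y. - k x y) M) c (\<lambda>x. - u x)" by (simp add: shift_op_kop_uminus_arg)
  then show "w \<in> shift_op (kop (\<lambda>x y. - k x y) M) c ` l2 M" using l2_uminus[OF u(1)] by blast
qed

lemma spectrum_kop_uminus:
  "c \<in> spectrum_l2 M (kop (\<lambda>x y. - k x y) M) \<longleftrightarrow> - c \<in> spectrum_l2 M (kop k M)"
proof -
  have "inj_on (shift_op (kop (\<lambda>x y. - k x y) M) c) (l2 M) \<longleftrightarrow> inj_on (shift_op (kop k M) (- c)) (l2 M)"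
    unfolding inj_on_def shift_op_kop_uminus by (simp add: fun_eq_iff)
  then show ?thesis by (simp add: spectrum_l2_def bij_betw_def shift_op_kop_uminus_image)
qed

lemma ess_spectrum_kop_uminus:
  "c \<in> ess_spectrum_l2 M (kop (\<lambda>x y. - k x y) M) \<longleftrightarrow> - c \<in> ess_spectrum_l2 M (kop k M)"
proof -
  have "shift_op (kop (\<lambda>x y. - k x y) M) c u = (\<lambda>_. 0) \<longleftrightarrow> shift_op (kop k M) (- c) u = (\<lambda>_. 0)" for u
    unfolding shift_op_kop_uminus by (simp add: fun_eq_iff)
  then show ?thesis by (simp add: ess_spectrum_l2_def fredholm_l2_def shift_op_kop_uminus_image)
qed

text \<open>On the reals the infimum is by definition the negated supremum of the negated set, so
  the identity also covers empty and unbounded sets.\<close>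

lemma Sup_real_part_set_eq:
  assumes "\<And>c. c \<in> A \<longleftrightarrow> - c \<in> B"
  shows "Sup (real_part_set B) = - Inf (real_part_set A)"
proof -
  have "real_part_set A = uminus ` real_part_set B"
  proof (intro equalityI subsetI)
    fix t assume "t \<in> real_part_set A"
    then have "- t \<in> real_part_set B" using assms by (simp add: real_part_set_def)
    then show "t \<in> uminus ` real_part_set B" by (intro image_eqI[of _ _ "- t"]) simp_all
  next
    fix t assume "t \<in> uminus ` real_part_set B"
    then obtain s where "t = - s" "complex_of_real s \<in> B" by (auto simp: real_part_set_def)
    then show "t \<in> real_part_set A" using assms[of "complex_of_real t"] by (simp add: real_part_set_def)
  qed
  then show ?thesis by (simp add: Inf_real_def image_image)
qed

lemma (in hermitian_kernel) hermitian_kernel_uminus: "hermitian_kernel S (\<lambda>x y. - k x y) N C"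
proof
  show "- k y x = cnj (- k x y)" if "x \<in> S" "y \<in> S" for x y using herm[OF that] by simp
qed (simp_all add: bound fin_row card_row C_nonneg)

theorem (in hermitian_kernel) Sup_ess_spectrum_eq_INF:
  assumes "\<And>M. M \<in> \<M> \<Longrightarrow> M \<subseteq> S" and "\<And>M. M \<in> \<M> \<Longrightarrow> M \<noteq> {}"
    and "\<And>M. M \<in> \<M> \<Longrightarrow> finite (S - M)"
    and "\<And>F. finite F \<Longrightarrow> F \<subseteq> S \<Longrightarrow> \<exists>M\<in>\<M>. M \<inter> F = {}"
  shows "Sup (real_part_set (ess_spectrum_l2 S (kop k S))) =
    (INF M\<in>\<M>. Sup (real_part_set (spectrum_l2 M (kop k M))))"
proof -
  interpret m: hermitian_kernel S "\<lambda>x y. - k x y" N C by (rule hermitian_kernel_uminus)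
  have "Sup (real_part_set (ess_spectrum_l2 S (kop k S)))
      = - Inf (real_part_set (ess_spectrum_l2 S (kop (\<lambda>x y. - k x y) S)))"
    by (rule Sup_real_part_set_eq) (rule ess_spectrum_kop_uminus)
  also have "\<dots> = - (SUP M\<in>\<M>. Inf (real_part_set (spectrum_l2 M (kop (\<lambda>x y. - k x y) M))))"
    by (simp only: m.Inf_ess_spectrum_eq_SUP[OF assms])
  also have "\<dots> = - (SUP M\<in>\<M>. - Sup (real_part_set (spectrum_l2 M (kop k M))))"
    by (simp only: Sup_real_part_set_eq[OF spectrum_kop_uminus] minus_minus)
  also have "\<dots> = (INF M\<in>\<M>. Sup (real_part_set (spectrum_l2 M (kop k M))))"
    by (simp add: Inf_real_def image_image)
  finally show ?thesis .
qed

theorem theorem7p4: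
  fixes r d :: "'g::t2_space \<Rightarrow> 'g" and mul :: "'g \<Rightarrow> 'g \<Rightarrow> 'g" and iv :: "'g \<Rightarrow> 'g"
    and Xinf :: "'g set" and T :: "'g set set" and h :: "'g \<Rightarrow> complex"
  assumes std: "standard_manageable r d mul iv Xinf"
    and T_closed: "closedin (fell_topology (unit_space r)) T"
    and T_acc: "\<forall>U. openin (fell_topology (unit_space r)) U \<and> Xinf \<in> U \<longrightarrow>
                   (\<exists>M\<in>T. M \<noteq> Xinf \<and> M \<in> U)"
    and T0_contains: "\<forall>M \<in> T - {Xinf}. Xinf \<subseteq> M"
    and T0_relcpt: "\<forall>M \<in> T - {Xinf}.
                      compact ((unit_space r - Xinf) \<inter> closure (unit_space r - M))"
    and h_Cc: "Cc h"
    and h_sa: "\<forall>\<xi>. h (iv \<xi>) = cnj (h \<xi>)"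
  shows "Inf (real_part_set (ess_spectrum_l2 (unit_space r - Xinf)
                (kernel_op r d h (unit_space r - Xinf))))
           = (SUP M \<in> T - {Xinf}. Inf (real_part_set (spectrum_l2 (M \<inter> (unit_space r - Xinf))
                (kernel_op r d h (M \<inter> (unit_space r - Xinf))))))
       \<and> Sup (real_part_set (ess_spectrum_l2 (unit_space r - Xinf)
                (kernel_op r d h (unit_space r - Xinf))))
           = (INF M \<in> T - {Xinf}. Sup (real_part_set (spectrum_l2 (M \<inter> (unit_space r - Xinf))
                (kernel_op r d h (M \<inter> (unit_space r - Xinf))))))"
proof -
  define X0 where "X0 = unit_space r - Xinf"
  define k where "k x y = h (theta r d x y)" for x y
  define \<M> where "\<M> = (\<lambda>M. M \<inter> X0) ` (T - {Xinf})"
  have man: "manageable r d mul iv" and Xc: "closed Xinf" and XX: "Xinf \<subseteq> unit_space r"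
    and orb: "\<And>x y. x \<in> X0 \<Longrightarrow> y \<in> X0 \<Longrightarrow> \<exists>\<xi>. r \<xi> = x \<and> d \<xi> = y"
    and triv: "\<And>\<xi>. r \<xi> \<in> X0 \<Longrightarrow> d \<xi> = r \<xi> \<Longrightarrow> \<xi> = r \<xi>"
    using std unfolding standard_manageable_def Let_def X0_def by auto
  have gr: "groupoid r d mul iv" and lr: "local_homeo_onto r (unit_space r)"
    using man unfolding manageable_def etale_def topological_groupoid_def by auto
  have th: "theta r d x y = \<xi>" if "r \<xi> = x" "d \<xi> = y" "y \<in> X0" for x y \<xi>
    unfolding theta_def using that groupoid_eq_if_trivial_isotropy[OF gr triv]
    by (intro the_equality) auto
  have th_rd: "r (theta r d x y) = x \<and> d (theta r d x y) = y" if "x \<in> X0" "y \<in> X0" for x y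
    using orb[OF that] th that by metis
  obtain N where N: "\<And>x. finite {\<xi>. r \<xi> = x \<and> h \<xi> \<noteq> 0}" "\<And>x. card {\<xi>. r \<xi> = x \<and> h \<xi> \<noteq> 0} \<le> N"
    using Cc_fibre_card_bounded[OF h_Cc local_homeo_onto_inj[OF lr]] by metis
  obtain B where B: "\<And>\<xi>. norm (h \<xi>) \<le> B" "B \<ge> 0" using bounded_if_Cc[OF h_Cc] by metis
  \<comment> \<open>The domain map recovers y from \<open>theta r d x y\<close>, so the nonzero
    entries of row x embed into the part of the r-fibre over x where h is nonzero.\<close>
  have row: "theta r d x ` {y \<in> X0. k x y \<noteq> 0} \<subseteq> {\<xi>. r \<xi> = x \<and> h \<xi> \<noteq> 0}"
    "inj_on (theta r d x) {y \<in> X0. k x y \<noteq> 0}" if "x \<in> X0" for x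
    using th_rd[OF that] by (auto simp: k_def inj_on_def) metis
  interpret hermitian_kernel X0 k N B
  proof
    show "k y x = cnj (k x y)" if "x \<in> X0" "y \<in> X0" for x y
    proof -
      have "r (iv (theta r d x y)) = y" "d (iv (theta r d x y)) = x"
        using gr th_rd[OF that] unfolding groupoid_def by auto
      \<comment> \<open>Inversion swaps range and domain, so self-adjointness of h becomes Hermitian
        symmetry of k.\<close>
      then have "theta r d y x = iv (theta r d x y)" using th that by blast
      then show ?thesis using h_sa by (simp add: k_def)
    qed
    show "finite {y \<in> X0. k x y \<noteq> 0}" if "x \<in> X0" for x
      by (rule inj_on_finite[OF row(2)[OF that] row(1)[OF that] N(1)])
    show "card {y \<in> X0. k x y \<noteq> 0} \<le> N" if "x \<in> X0" for x
      using card_inj_on_le[OF row(2)[OF that] row(1)[OF that] N(1)] N(2)[of x] by (rule order_trans)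
  qed (use B in \<open>auto simp: k_def\<close>)
  have iso: "openin (top_of_set (unit_space r)) {y}" if "y \<in> X0" for y
    using standard_main_orbit_isolated[OF std] that by (simp add: X0_def)
  have fincpt: "finite K" if "compact K" "K \<subseteq> X0" for K
    using compact_subset_of_isolated_points_finite[of K "unit_space r"] that iso by (auto simp: X0_def)
  \<comment> \<open>Every generator of the Fell topology consists of closed subsets of the unit
    space, hence so does its topspace.\<close>
  have TX: "M \<subseteq> unit_space r" if "M \<in> T" for M
  proof -
    have "M \<in> topspace (fell_topology (unit_space r))" using closedin_subset[OF T_closed] that by blast
    then show ?thesis
      by (auto simp: fell_topology_def dest!: closedin_imp_subset)
  qed
  have sub: "M \<subseteq> X0" if "M \<in> \<M>" for M using that by (auto simp: \<M>_def)
  \<comment> \<open>A set between Xinf and the unit space, other than Xinf itself, meets X0.\<close>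
  have ne: "M \<noteq> {}" if "M \<in> \<M>" for M
  proof -
    from that obtain M' where M': "M' \<in> T" "M' \<noteq> Xinf" "M = M' \<inter> X0" by (auto simp: \<M>_def)
    then show ?thesis using TX[OF M'(1)] T0_contains by (auto simp: X0_def)
  qed
  have cofin: "finite (X0 - M)" if "M \<in> \<M>" for M
  proof -
    obtain M' where M': "M' \<in> T - {Xinf}" "M = M' \<inter> X0" using \<open>M \<in> \<M>\<close> unfolding \<M>_def by blast
    have "finite (X0 \<inter> closure (unit_space r - M'))"
      using T0_relcpt M'(1) by (intro fincpt) (auto simp: X0_def)
    moreover have "X0 - M \<subseteq> X0 \<inter> closure (unit_space r - M')"
      using closure_subset[of "unit_space r - M'"] by (auto simp: M'(2) X0_def)
    ultimately show ?thesis using finite_subset by blast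
  qed
  have avoid: "\<exists>M\<in>\<M>. M \<inter> F = {}" if "finite F" "F \<subseteq> X0" for F
  proof -
    \<comment> \<open>The basic Fell neighbourhood of Xinf with compact set F and the empty family
      of open sets: the closed sets that miss F.\<close>
    define U where "U = {A. closedin (top_of_set (unit_space r)) A \<and> A \<inter> F = {} \<and> (\<forall>V\<in>{}. A \<inter> V \<noteq> {})}"
    have "openin (fell_topology (unit_space r)) U"
      unfolding fell_topology_def
    proof (rule topology_generated_by_Basis, unfold mem_Collect_eq, intro exI conjI)
      show "U = {A. closedin (top_of_set (unit_space r)) A \<and> A \<inter> F = {} \<and> (\<forall>V\<in>{}. A \<inter> V \<noteq> {})}"
        by (rule U_def)
      show "compact F" by (rule finite_imp_compact[OF that(1)])
      show "F \<subseteq> unit_space r" using that(2) by (auto simp: X0_def)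
    qed auto
    moreover have "Xinf \<in> U" using Xc XX that by (auto simp: U_def X0_def closed_subset)
    ultimately obtain M where "M \<in> T" "M \<noteq> Xinf" "M \<in> U" using T_acc by blast
    then show ?thesis by (auto simp: \<M>_def U_def)
  qed
  have kop: "kernel_op r d h Y = kop k Y" for Y by (simp add: kernel_op_eq_kop k_def[abs_def])
  show ?thesis
    using Inf_ess_spectrum_eq_SUP[OF sub ne cofin avoid] Sup_ess_spectrum_eq_INF[OF sub ne cofin avoid]
    unfolding kop X0_def[symmetric] \<M>_def image_image by blast
qed

end
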